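(* Let $m,n$ be positive integers with $n\ge 2m$, and let $$S=\sum_{k=1}^\infty \frac{\left(\psi\left(\frac{2k+2n+5}{4}\right)-\psi\left(\frac{2k+2n+3}{4}\right)\right)\left(\frac12-(-1)^k\right)}{(2k+4m)^2}.$$ Then: (i) if $n=2m$: $$S=2-\sum_{k=1}^{2m}\sum_{j=0}^k\frac{(-1)^j\left(\frac12(-1)^k-1\right)}{k^2(2j+1)}+\left(-1+\sum_{k=1}^{2m}\frac{\frac12(-1)^k-1}{4k^2}\right)\pi+\frac{\pi^2}{6}-\frac{\pi^3}{96};$$ (ii) if $n=2m+1$: $$S=-\frac{70}{27}+\sum_{k=1}^{2m}\sum_{j=0}^{k+1}\frac{(-1)^j\left(\frac12(-1)^k-1\right)}{k^2(2j+1)}+\left(\frac{10}{9}-\sum_{k=1}^{2m}\frac{\frac12(-1)^k-1}{4k^2}\right)\pi-\frac{\pi^2}{9}+\frac{\pi^3}{96};$$ (iii) if $n-2m$ is odd and $n-2m\neq1$: $$\begin{aligned}S={}&-\frac{70}{27}+8\sum_{j=1}^{\frac{n-2m-1}{2}}\frac{(2j+1)(2H_{4j+1}-H_{2j})}{(4j+3)^2(4j+1)^2}+2\sum_{j=1}^{\frac{n-2m-1}{2}}\frac{1}{(4j+3)^3}-\sum_{k=1}^{2m}\sum_{j=0}^{k+n-2m}\frac{(-1)^{j+n}\left(\frac12(-1)^k-1\right)}{k^2(2j+1)}\\&-8\sum_{k=1}^{\frac{n-2m-1}{2}}\sum_{j=0}^{2k}\frac{(-1)^j(16k^2+16k+5)}{(2j+1)(4k+3)^2(4k+1)^2}\\&+\left(\frac{10}{9}+\sum_{j=1}^{\frac{n-2m-1}{2}}\frac{2(16j^2+16j+5)}{(4j+3)^2(4j+1)^2}+\sum_{k=1}^{2m}\frac{(-1)^n\left(\frac12(-1)^k-1\right)}{4k^2}\right)\pi\\&-\left(\frac19+\frac13\sum_{j=1}^{\frac{n-2m-1}{2}}\frac{1}{(4j+3)(4j+1)}\right)\pi^2+\frac{\pi^3}{96};\end{aligned}$$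 (iv) if $n-2m$ is even: $$\begin{aligned}S={}&2+16\sum_{j=0}^{\frac{n-2m-2}{2}}\frac{(j+1)(2H_{4j+3}-H_{2j+1})}{(4j+5)^2(4j+3)^2}+2\sum_{j=0}^{\frac{n-2m-2}{2}}\frac{1}{(4j+5)^3}-\sum_{k=1}^{2m}\sum_{j=0}^{k+n-2m}\frac{(-1)^{j+n}\left(\frac12(-1)^k-1\right)}{k^2(2j+1)}\\&+8\sum_{k=0}^{\frac{n-2m-2}{2}}\sum_{j=0}^{2k+1}\frac{(-1)^j(16k^2+32k+17)}{(2j+1)(4k+5)^2(4k+3)^2}\\&+\left(-1-\sum_{j=0}^{\frac{n-2m-2}{2}}\frac{2(16j^2+32j+17)}{(4j+5)^2(4j+3)^2}+\sum_{k=1}^{2m}\frac{(-1)^n\left(\frac12(-1)^k-1\right)}{4k^2}\right)\pi\\&+\left(\frac12-\sum_{j=0}^{\frac{n-2m-2}{2}}\frac{1}{(4j+5)(4j+3)}\right)\frac{\pi^2}{3}-\frac{\pi^3}{96}.\end{aligned}$$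
   Context: $\psi=\Gamma'/\Gamma$ is the digamma function and $H_n=\sum_{k=1}^n\frac1k$ is the $n$-th harmonic number. Empty sums (such as $\sum_{j=0}^{-1}$) are $0$. *)

theory Defs
  imports "HOL-Analysis.Analysis"
begin

(* Digamma is Gamma' / Gamma: see has_field_derivative_Gamma in HOL-Analysis. *)
definition digamma_summand :: "nat \<Rightarrow> nat \<Rightarrow> nat \<Rightarrow> real" where
  "digamma_summand m n k =
     (Digamma ((2 * real k + 2 * real n + 5) / 4) - Digamma ((2 * real k + 2 * real n + 3) / 4))
       * (1 / 2 - (- 1) ^ k) / (2 * real k + 4 * real m)\<^sup>2"

end

theory Submission
  imports Defs "HOL-Complex_Analysis.Complex_Analysis" "HOL-Real_Asymp.Real_Asymp"
begin

text \<open>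
  Let $r(N) = \sum_{i\ge N} (-1)^i/(2i+1)$ be the tails of the Leibniz series for $\pi/4$. A first-order
  recurrence in $k+n$ identifies the digamma difference with $\pm 4\,r(k+n+1)$. After reindexing by
  $N = k+2m$ the series becomes a tail of $\sum_N c_N\, r(N+d+1)$ with $c_N = (1-\frac12(-1)^N)/N^2$ and
  $d = n-2m$. Increasing $d$ by one changes the value by a series with a closed form (digamma at
  half-integers, $\sum 1/N^2$), so all four cases reduce to the single evaluation, at $d = -1$,
  of $\sum_N c_N\, r(N) = -\pi^3/96$.

  With $r(N) = (-1)^N \int_0^1 x^{2N}/(1+x^2)\,dx$ and an integration by parts this value is
  $-\pi^3/24 + I - E$, where
  $I = \int_0^1 \frac{\arctan x}{x}\ln(1+x^2)\,dx$ and
  $E = \int_0^1 \frac{\arctan x}{x}\ln\frac{1-x^2}{1+x^2}\,dx$.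
  Neither integral is elementary, but both are tied to
  $T = -\int_0^{\pi/2} \ln\tan(t/2)\,\ln(2\sin t)\,dt$. Expanding in powers of $\sin t$ (after
  $x = \tan(t/2)$) respectively $\cos t$ turns $2E$ and $T$ into the same series, so $2E = T$. Cauchy's
  theorem for $(\mathrm{Ln}^2(1+z)-\mathrm{Ln}^2(1-z))/z$ on the quarter disc gives
  $2I = T + \pi^3/16$. Hence $I - E = \pi^3/32$.
\<close>

subsection \<open>Tails of the Leibniz series\<close>

text \<open>The squared logarithms are chosen for their boundary values. At z = e^(it), Ln(1+z) and
  Ln(1-z) have real parts a = ln(2 cos(t/2)), b = ln(2 sin(t/2)) and imaginary parts t/2, t/2 -
  pi/2. So the difference of the squares has real part (a-b)(a+b) + pi^2/4 - pi t/2: the integrand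
  of T plus a linear function, whose integral is pi^3/16. On the imaginary axis the two logarithms
  are conjugate and the imaginary part of the difference is 2 arctan y ln(1+y^2); on the real axis
  it vanishes. The base point is d = -1 because there the exponent 2N of x has no offset against the
  index of c_N, so that the sum under the integral consists of ln(1+x^2) and ln(1-x^2) alone. The
  boundary term of the integration by parts is -pi^3/24 = (pi/4)(-pi^2/6). The obstacle throughout
  is the logarithmic singularities: at endpoints of the real integrals, and at z = 1 on the contour.
  Hence open intervals, dominated convergence with explicit logarithmic majorants, and arcs of
  radius below 1 followed by a limit.\<close>

definition leib :: "nat \<Rightarrow> real" where
  "leib n = pi / 4 - (\<Sum>i<n. (- 1) ^ i / (2 * real i + 1))"

lemma leib_Suc: "leib (Suc n) = leib n - (- 1) ^ n / (2 * real n + 1)"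
  by (simp add: leib_def)

lemma sums_leibniz: "(\<lambda>i. (- 1) ^ i / (2 * real i + 1)) sums (pi / 4)"
proof -
  have "summable (\<lambda>k. (-1::real)^k * (1 / real (k*2+1) * 1 ^ (k*2+1)))"
    by (rule summable_arctan_series) simp
  hence "summable (\<lambda>i. (- 1) ^ i / (2 * real i + 1))"
    by (simp add: algebra_simps)
  moreover have "(\<Sum>i. (- 1) ^ i / (2 * real i + 1)) = pi / 4"
    using pi_series by (simp add: algebra_simps)
  ultimately show ?thesis by (simp add: sums_iff)
qed

lemma leib_tendsto_0: "leib \<longlonglongrightarrow> 0"
proof -
  have "(\<lambda>n. pi / 4 - (\<Sum>i<n. (- 1) ^ i / (2 * real i + 1))) \<longlonglongrightarrow> pi / 4 - pi / 4"
    using sums_leibniz unfolding sums_def by (intro tendsto_intros)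
  thus ?thesis by (simp add: leib_def[abs_def])
qed

lemma sums_leib: "(\<lambda>i. (- 1) ^ (i + d) / (2 * real (i + d) + 1)) sums leib d"
  using sums_split_initial_segment[OF sums_leibniz, of d] by (simp add: leib_def)

text \<open>The two arguments are 1/2 apart and each moves by 1/2 when \<open>a\<close> grows by
  one, so the sum of two consecutive differences is Digamma(z+1) - Digamma(z) = 1/z. Up to signs
  this is the recurrence of the Leibniz tails. Hence \<open>u\<close> is constant, and it is 0
  because both of its parts tend to 0.\<close>

lemma Digamma_diff_eq_leib:
  "Digamma ((2 * real a + 5) / 4) - Digamma ((2 * real a + 3) / 4) = 4 * (- 1) ^ Suc a * leib (Suc a)"
proof -
  define G where "G a = Digamma ((2 * real a + 5) / 4) - Digamma ((2 * real a + 3) / 4)" for a :: nat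
  define u where "u a = (- 1) ^ a * G a + 4 * leib (Suc a)" for a
  have G_step: "G (Suc a) + G a = 4 / (2 * real a + 3)" for a
  proof -
    have "Digamma ((2 * real a + 3) / 4 + 1) = Digamma ((2 * real a + 3) / 4) + 1 / ((2 * real a + 3) / 4)"
      by (rule Digamma_plus1) auto
    moreover have "(2 * real a + 3) / 4 + 1 = (2 * real (Suc a) + 5) / 4"
      and arg: "(2 * real (Suc a) + 3) / 4 = (2 * real a + 5) / 4"
      by (simp_all add: field_simps)
    ultimately show ?thesis unfolding G_def arg by simp
  qed
  have G_nonneg: "G a \<ge> 0" for a
    unfolding G_def using Digamma_real_mono[of "(2 * real a + 3) / 4" "(2 * real a + 5) / 4"] by simp
  \<comment> \<open>Nonnegativity of the next term turns the recurrence itself into a decay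
    bound.\<close>
  have G_le: "G a \<le> 4 / (2 * real a + 3)" for a
    using G_step[of a] G_nonneg[of "Suc a"] by linarith
  have "(\<lambda>a. 4 / (2 * real a + 3)) \<longlonglongrightarrow> 0" by real_asymp
  hence "G \<longlonglongrightarrow> 0"
    by (rule Lim_null_comparison[rotated]) (use G_le G_nonneg in auto)
  hence "(\<lambda>a. (- 1) ^ a * G a) \<longlonglongrightarrow> 0"
    by (subst tendsto_rabs_zero_iff [symmetric]) (simp add: abs_mult power_abs tendsto_rabs_zero_iff)
  moreover have "(\<lambda>a. 4 * leib (Suc a)) \<longlonglongrightarrow> 4 * 0"
    using LIMSEQ_Suc[OF leib_tendsto_0] by (intro tendsto_intros)
  ultimately have "(\<lambda>a. (- 1) ^ a * G a + 4 * leib (Suc a)) \<longlonglongrightarrow> 0 + 4 * 0"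
    by (rule tendsto_add)
  hence "u \<longlonglongrightarrow> 0" by (simp add: u_def[abs_def])
  moreover have "u (Suc a) = u a" for a
  proof -
    have "G (Suc a) = 4 / (2 * real a + 3) - G a" using G_step[of a] by simp
    note G_Suc = this
    show ?thesis unfolding u_def leib_Suc[of "Suc a"] G_Suc by (simp add: algebra_simps)
  qed
  hence u_const: "u n = u 0" for n by (induction n) auto
  hence "u = (\<lambda>_. u a)" by (intro ext) (metis u_const)
  ultimately have "(\<lambda>_::nat. u a) \<longlonglongrightarrow> 0" by metis
  hence "u a = 0" using LIMSEQ_const_iff by blast
  hence "(- 1) ^ a * G a = - 4 * leib (Suc a)"
    unfolding u_def by simp
  hence "(- 1) ^ a * ((- 1) ^ a * G a) = (- 1) ^ a * (- 4 * leib (Suc a))"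
    by (simp only:)
  hence "G a = (- 1) ^ a * (- 4 * leib (Suc a))"
    by (simp add: mult.assoc[symmetric] power_add[symmetric])
  thus ?thesis by (simp add: G_def)
qed

section \<open>Odd harmonic numbers, the alternating series of inverse squares and the
  weights\<close>

definition odd_harm :: "nat \<Rightarrow> real" where
  "odd_harm n = (\<Sum>i<n. 1 / (2 * real i + 1))"

lemma odd_harm_Suc: "odd_harm (Suc n) = odd_harm n + 1 / (2 * real n + 1)"
  by (simp add: odd_harm_def)

text \<open>In H_(2n+1) the even denominators contribute H_n / 2. This is the origin of the
  combinations 2 H_(4j+1) - H_(2j) and 2 H_(4j+3) - H_(2j+1) in the result.\<close>

lemma odd_harm_eq_harm: "2 * odd_harm (Suc n) = 2 * harm (2 * n + 1) - harm n"
proof (induction n)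
  case 0
  show ?case by (simp add: odd_harm_def harm_def)
next
  case (Suc n)
  have "harm (2 * Suc n + 1) = harm (2 * n + 1) + 1 / (2 * real n + 2) + 1 / (2 * real n + 3)"
    by (simp add: harm_Suc inverse_eq_divide add_ac)
  moreover have "2 / (2 * real n + 2) = 1 / real (Suc n)"
    by (simp add: field_simps)
  moreover have "harm (Suc n) = harm n + 1 / real (Suc n)"
    by (simp add: harm_Suc inverse_eq_divide)
  ultimately show ?case
    using Suc by (simp add: odd_harm_Suc[of "Suc n"] add_ac)
qed

text \<open>Twice the terms of even index minus all terms: (-1)^N = (1 + (-1)^N) - 1.\<close>

lemma sums_alternating_inverse_squares: "(\<lambda>n. (- 1) ^ Suc n / (real (Suc n))\<^sup>2) sums (- (pi\<^sup>2 / 12))"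
proof -
  have A: "(\<lambda>n. 1 / (real (Suc n))\<^sup>2) sums (pi\<^sup>2 / 6)"
    using inverse_squares_sums by (simp add: add.commute)
  have "(\<lambda>n. 2 * (1 / (2 * real (Suc n))\<^sup>2)) sums (2 * (pi\<^sup>2 / 6 / 4))"
    using sums_mult[OF sums_divide[OF A, of 4], of 2] by (simp add: power2_eq_square field_simps)
  moreover have "strict_mono (\<lambda>n::nat. 2 * n + 1)" by (auto simp: strict_mono_def)
  moreover have "n \<in> range (\<lambda>n. 2 * n + 1)" if "odd n" for n :: nat
    using that by (auto elim!: oddE)
  ultimately have "(\<lambda>n. (1 + (- 1) ^ Suc n) / (real (Suc n))\<^sup>2) sums (2 * (pi\<^sup>2 / 6 / 4))"
    by (subst sums_mono_reindex[of "\<lambda>n. 2 * n + 1", symmetric]) (auto simp: algebra_simps uminus_power_if)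
  from sums_diff[OF this A] show ?thesis by (simp add: field_simps)
qed

text \<open>The c_N of the overview. It arises from the factor 1/2 - (-1)^N of the summand once the
  sign -(-1)^N that accompanies the Leibniz tail is multiplied in.\<close>

definition weight :: "nat \<Rightarrow> real" where
  "weight k = (1 - 1 / 2 * (- 1) ^ k) / (real k)\<^sup>2"

subsection \<open>Reduction to integrals\<close>

lemma integral_sums_dominated:
  fixes f :: "nat \<Rightarrow> real \<Rightarrow> real"
  assumes f: "\<And>k. (f k has_integral I k) S" and h: "h integrable_on S"
    and le: "\<And>n x. x \<in> S \<Longrightarrow> \<bar>\<Sum>k<n. f k x\<bar> \<le> h x"
    and g: "\<And>x. x \<in> S \<Longrightarrow> (\<lambda>k. f k x) sums g x"
  shows "g integrable_on S" "I sums integral S g"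
proof -
  have int: "((\<lambda>x. \<Sum>k<n. f k x) has_integral (\<Sum>k<n. I k)) S" for n
    using f by (intro has_integral_sum) auto
  have conv: "g integrable_on S" "(\<lambda>n. integral S (\<lambda>x. \<Sum>k<n. f k x)) \<longlonglongrightarrow> integral S g"
    using dominated_convergence[of "\<lambda>n x. \<Sum>k<n. f k x" S h g] int h le g
    by (auto simp: sums_def)
  show "g integrable_on S" by fact
  show "I sums integral S g"
    using conv(2) integral_unique[OF int] by (simp add: sums_def)
qed

text \<open>The endpoint values of \<open>F\<close> must be its one-sided limits. Since
  \<open>ln 0 = 0\<close>, primitives with terms such as x * ln x already take these values, so no
  case distinction at a singular endpoint is needed.\<close>

lemma has_integral_FTC_Ioo:
  fixes F :: "real \<Rightarrow> real"
  assumes "a < b" and "(F \<longlongrightarrow> F a) (at_right a)" and "(F \<longlongrightarrow> F b) (at_left b)"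
    and F: "\<And>x. a < x \<Longrightarrow> x < b \<Longrightarrow> (F has_real_derivative f x) (at x)"
  shows "(f has_integral (F b - F a)) {a<..<b}"
  unfolding has_integral_Icc_iff_Ioo[symmetric]
proof (rule fundamental_theorem_of_calculus_interior)
  have "isCont F x" if "a < x" "x < b" for x
    using F[OF that] by (rule DERIV_isCont)
  thus "continuous_on {a..b} F"
    using assms by (intro continuous_on_IccI) (auto simp: isCont_def)
qed (use assms in \<open>auto simp: has_real_derivative_iff_has_vector_derivative\<close>)

text \<open>Makes multiples of -ln(1 - x^2) available as integrable majorants.\<close>

lemma has_integral_ln_one_minus_square:
  "((\<lambda>x. ln (1 - x\<^sup>2)) has_integral (2 * ln 2 - 2)) {0<..<1::real}"
proof -
  define F :: "real \<Rightarrow> real" where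
    "F = (\<lambda>x. - (1 - x) * ln (1 - x) + (1 + x) * ln (1 + x) - 2 * x)"
  have "((\<lambda>x. ln (1 - x\<^sup>2)) has_integral (F 1 - F 0)) {0<..<1}"
  proof (rule has_integral_FTC_Ioo)
    show "(F \<longlongrightarrow> F 0) (at_right 0)" unfolding F_def by real_asymp
    show "(F \<longlongrightarrow> F 1) (at_left 1)" unfolding F_def by (simp, real_asymp)
  next
    fix x :: real assume x: "0 < x" "x < 1"
    have "1 - x\<^sup>2 = (1 - x) * (1 + x)" by (simp add: power2_eq_square algebra_simps)
    hence "ln (1 - x\<^sup>2) = ln (1 - x) + ln (1 + x)" using x by (simp add: ln_mult)
    moreover have "((\<lambda>x. - (1 - x) * ln (1 - x)) has_real_derivative ln (1 - x) + 1) (at x)"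
      "((\<lambda>x. (1 + x) * ln (1 + x)) has_real_derivative ln (1 + x) + 1) (at x)"
      "((\<lambda>x. 2 * x) has_real_derivative 2) (at x)"
      using x by (auto intro!: derivative_eq_intros simp: field_simps)
    from DERIV_diff[OF DERIV_add[OF this(1,2)] this(3)]
    have "(F has_real_derivative ln (1 - x) + ln (1 + x)) (at x)"
      unfolding F_def by simp
    ultimately show "(F has_real_derivative ln (1 - x\<^sup>2)) (at x)" by simp
  qed simp
  thus ?thesis by (simp add: F_def)
qed

text \<open>Integration by parts would leave the integral of x^(2n)/(1+x^2), which is (-1)^n
  \<open>leib n\<close>. The induction avoids that quotient: in the sum of the integrands for n and
  n+1 the factor x^(2n+2) + x^(2n) is divisible by 1 + x^2, which cancels the derivative of
  arctan.\<close>

lemma has_integral_arctan_power: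
  "((\<lambda>x. real (2 * n) * (arctan x * x ^ (2 * n - 1))) has_integral (pi / 4 - (- 1) ^ n * leib n)) {0<..<1}"
proof (induction n)
  case 0
  \<comment> \<open>The truncated exponent 2 * 0 - 1 = 0 is harmless, as the factor
    \<open>real (2 * n)\<close> vanishes.\<close>
  show ?case by (simp add: leib_def)
next
  case (Suc n)
  define F where "F = (\<lambda>x::real. arctan x * (x ^ (2 * n + 2) + x ^ (2 * n)) - x ^ (2 * n + 1) / real (2 * n + 1))"
  define f where "f = (\<lambda>n x. real (2 * n) * (arctan x * x ^ (2 * n - 1)))"
  have "((\<lambda>x. f (Suc n) x + f n x) has_integral (F 1 - F 0)) {0<..<1}"
  proof (rule has_integral_FTC_Ioo)
    have "isCont F x" for x
      unfolding F_def by (intro continuous_intros) auto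
    thus "(F \<longlongrightarrow> F 0) (at_right 0)" "(F \<longlongrightarrow> F 1) (at_left 1)"
      by (simp_all add: continuous_at_imp_continuous_at_within continuous_within[symmetric])
  next
    fix x :: real assume x: "0 < x" "x < 1"
    have pos: "1 + x\<^sup>2 > 0" by (simp add: add_pos_nonneg)
    have "(F has_real_derivative (arctan x * (real (2 * n + 2) * x ^ (2 * n + 1) + real (2 * n) * x ^ (2 * n - 1))
        + inverse (1 + x\<^sup>2) * (x ^ (2 * n + 2) + x ^ (2 * n)) - x ^ (2 * n))) (at x)"
    proof -
      have "((\<lambda>x. x ^ (2 * n + 2)) has_real_derivative real (2 * n + 2) * x ^ (2 * n + 1)) (at x)"
        "((\<lambda>x. x ^ (2 * n)) has_real_derivative real (2 * n) * x ^ (2 * n - 1)) (at x)"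
        using DERIV_pow[of "2 * n + 2" x] DERIV_pow[of "2 * n" x] by simp_all
      from DERIV_mult[OF DERIV_arctan[of x] DERIV_add[OF this]]
      have "((\<lambda>x. arctan x * (x ^ (2 * n + 2) + x ^ (2 * n))) has_real_derivative
          arctan x * (real (2 * n + 2) * x ^ (2 * n + 1) + real (2 * n) * x ^ (2 * n - 1))
          + inverse (1 + x\<^sup>2) * (x ^ (2 * n + 2) + x ^ (2 * n))) (at x)"
        by (simp only: mult.commute add.commute)
      moreover have "((\<lambda>x. x ^ (2 * n + 1) / real (2 * n + 1)) has_real_derivative x ^ (2 * n)) (at x)"
        using DERIV_cdivide[OF DERIV_pow[of "2 * n + 1" x], of "real (2 * n + 1)"] by simp
      ultimately show ?thesis
        unfolding F_def by (rule DERIV_diff)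
    qed
    also have "x ^ (2 * n + 2) + x ^ (2 * n) = (1 + x\<^sup>2) * x ^ (2 * n)"
      by (simp add: power_add power2_eq_square algebra_simps)
    also have "inverse (1 + x\<^sup>2) * ((1 + x\<^sup>2) * x ^ (2 * n)) = x ^ (2 * n)"
      using pos by (simp flip: mult.assoc)
    finally have "(F has_real_derivative (arctan x * (real (2 * n + 2) * x ^ (2 * n + 1) + real (2 * n) * x ^ (2 * n - 1)))) (at x)"
      by simp
    thus "(F has_real_derivative (f (Suc n) x + f n x)) (at x)"
      by (simp add: f_def algebra_simps)
  qed simp
  moreover have "(f n has_integral (pi / 4 - (- 1) ^ n * leib n)) {0<..<1}"
    unfolding f_def by (rule Suc)
  ultimately have "((\<lambda>x. f (Suc n) x + f n x - f n x) has_integral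
      (F 1 - F 0 - (pi / 4 - (- 1) ^ n * leib n))) {0<..<1}"
    by (rule has_integral_diff)
  hence "(f (Suc n) has_integral (F 1 - F 0 - (pi / 4 - (- 1) ^ n * leib n))) {0<..<1}"
    by simp
  moreover have "F 1 - F 0 - (pi / 4 - (- 1) ^ n * leib n) = pi / 4 - (- 1) ^ Suc n * leib (Suc n)"
  proof -
    have "(- 1) ^ n * leib (Suc n) = (- 1) ^ n * leib n - (- 1) ^ n * (- 1) ^ n / (2 * real n + 1)"
      by (simp add: leib_Suc algebra_simps)
    also have "(- 1 :: real) ^ n * (- 1) ^ n = 1" by (simp add: power_add[symmetric])
    finally show ?thesis
      by (simp add: F_def arctan_one power_0_left)
  qed
  ultimately show ?case by (simp only: f_def)
qed

lemma sums_ln_one_plus: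
  assumes "\<bar>y::real\<bar> < 1"
  shows "(\<lambda>k. (- y) ^ Suc k / real (Suc k)) sums (- ln (1 + y))"
proof -
  have "(\<lambda>n. - (- ((- y) ^ n) / of_nat n)) sums - ln (1 + y)"
    using sums_minus[OF ln_series'[OF assms]] by simp
  hence "(\<lambda>n. (- y) ^ n / real n) sums - ln (1 + y)" by simp
  thus ?thesis by (subst sums_Suc_iff) simp
qed

text \<open>Replacing \<open>leib\<close> by its integral splits each term in two. The multiples of
  pi/4 sum to (pi/4)(-pi^2/12 - pi^2/12) = -pi^3/24. In the other part the factor 2N cancels one N
  of the denominator N^2, which leaves logarithmic series in x^2 under the integral.\<close>

lemma sums_weight_leib:
  defines "g \<equiv> \<lambda>x::real. arctan x / x * (2 * ln (1 + x\<^sup>2) - ln (1 - x\<^sup>2))"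
  shows "g integrable_on {0<..<1}"
    and "(\<lambda>k. weight (Suc k) * leib (Suc k)) sums (integral {0<..<1} g - pi ^ 3 / 24)"
proof -
  define f where "f k x = - weight (Suc k) * (- 1) ^ Suc k * (real (2 * Suc k) * (arctan x * x ^ (2 * Suc k - 1)))"
    for k and x :: real
  define I where "I k = weight (Suc k) * leib (Suc k) - pi / 4 * (((- 1) ^ Suc k - 1 / 2) / (real (Suc k))\<^sup>2)" for k
  have e2: "(- 1 :: real) ^ Suc k * (- 1) ^ Suc k = 1" for k by (simp only: power_add[symmetric]) simp
  have weight_alt: "weight (Suc k) * (- 1) ^ Suc k = ((- 1) ^ Suc k - 1 / 2) / (real (Suc k))\<^sup>2" for k
  proof -
    define e where "e = (- 1 :: real) ^ Suc k"
    have "weight (Suc k) * e = (e - 1 / 2 * (e * e)) / (real (Suc k))\<^sup>2"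
      by (simp only: weight_def e_def[symmetric]) (simp add: algebra_simps)
    moreover have "e * e = 1" using e2 by (simp add: e_def)
    ultimately show ?thesis by (simp add: e_def)
  qed
  have int: "(f k has_integral I k) {0<..<1}" for k
  proof -
    have "(f k has_integral (- weight (Suc k) * (- 1) ^ Suc k * (pi / 4 - (- 1) ^ Suc k * leib (Suc k)))) {0<..<1}"
      unfolding f_def by (rule has_integral_mult_right[OF has_integral_arctan_power])
    also have "- weight (Suc k) * (- 1) ^ Suc k * (pi / 4 - (- 1) ^ Suc k * leib (Suc k)) =
        weight (Suc k) * ((- 1) ^ Suc k * (- 1) ^ Suc k) * leib (Suc k) - pi / 4 * (weight (Suc k) * (- 1) ^ Suc k)"
      by (simp only: algebra_simps)
    finally show ?thesis by (simp only: e2 weight_alt I_def) simp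
  qed
  have f_eq: "f k x = arctan x / x * (- 2 * (((- 1) ^ Suc k - 1 / 2) / real (Suc k) * (x\<^sup>2) ^ Suc k))"
    if "x > 0" for k x
  proof -
    have "x * x ^ (2 * Suc k - 1) = (x\<^sup>2) ^ Suc k"
      by (simp add: power_mult[symmetric] power_Suc[symmetric] del: power_Suc)
    hence "x ^ (2 * Suc k - 1) = (x\<^sup>2) ^ Suc k / x" using that by (simp add: field_simps)
    moreover have "weight (Suc k) * (- 1) ^ Suc k * real (2 * Suc k) = 2 * (((- 1) ^ Suc k - 1 / 2) / real (Suc k))"
    proof -
      define N where "N = real (Suc k)"
      have "N > 0" "real (2 * Suc k) = 2 * N" by (simp_all add: N_def)
      thus ?thesis unfolding weight_alt N_def[symmetric] by (simp add: power2_eq_square)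
    qed
    ultimately show ?thesis
      unfolding f_def by (simp only: mult.assoc[symmetric] mult_minus_left) (simp add: mult_ac)
  qed
  have sums_sq: "(\<lambda>k. (x\<^sup>2) ^ Suc k / real (Suc k)) sums (- ln (1 - x\<^sup>2))"
    "(\<lambda>k. (- 1) ^ Suc k * (x\<^sup>2) ^ Suc k / real (Suc k)) sums (- ln (1 + x\<^sup>2))"
    if "x \<in> {0<..<1}" for x :: real
  proof -
    have "\<bar>x\<^sup>2\<bar> < 1" using that by (simp add: power_less_one_iff abs_square_less_1)
    thus "(\<lambda>k. (x\<^sup>2) ^ Suc k / real (Suc k)) sums (- ln (1 - x\<^sup>2))"
      "(\<lambda>k. (- 1) ^ Suc k * (x\<^sup>2) ^ Suc k / real (Suc k)) sums (- ln (1 + x\<^sup>2))"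
      using sums_ln_one_plus[of "- (x\<^sup>2)"] sums_ln_one_plus[of "x\<^sup>2"]
      by (simp_all only: power_minus[of "x\<^sup>2"]) (simp_all del: power_Suc)
  qed
  \<comment> \<open>With arctan x / x <= 1 and |(-1)^N - 1/2| <= 3/2 the terms are at most 3 x^(2N)
    / N.\<close>
  have le: "\<bar>\<Sum>k<n. f k x\<bar> \<le> - 3 * ln (1 - x\<^sup>2)" if x: "x \<in> {0<..<1}" for n x
  proof -
    have "\<bar>f k x\<bar> \<le> 3 * ((x\<^sup>2) ^ Suc k / real (Suc k))" for k
    proof -
      have "\<bar>f k x\<bar> = arctan x / x * (2 * (\<bar>(- 1) ^ Suc k - 1 / 2\<bar> * ((x\<^sup>2) ^ Suc k / real (Suc k))))"
        using x by (simp add: f_eq abs_mult del: power_Suc)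
      also have "\<dots> \<le> 1 * (2 * (3 / 2 * ((x\<^sup>2) ^ Suc k / real (Suc k))))"
      proof (intro mult_mono)
        show "arctan x / x \<le> 1" using x arctan_le_self[of x] by simp
        show "\<bar>(- 1) ^ Suc k - 1 / 2 :: real\<bar> \<le> 3 / 2"
          by (cases "even k") auto
      qed (use x in auto)
      finally show ?thesis by linarith
    qed
    hence "\<bar>\<Sum>k<n. f k x\<bar> \<le> (\<Sum>k<n. 3 * ((x\<^sup>2) ^ Suc k / real (Suc k)))"
      by (intro order_trans[OF sum_abs] sum_mono)
    also have "\<dots> \<le> 3 * (- ln (1 - x\<^sup>2))"
      using sums_mult[OF sums_sq(1)[OF x], of 3] by (intro sum_le_suminf[THEN order_trans]) (auto simp: sums_iff)
    finally show ?thesis by simp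
  qed
  have g: "(\<lambda>k. f k x) sums g x" if x: "x \<in> {0<..<1}" for x
  proof -
    have "(\<lambda>k. arctan x / x * (- 2 * ((- 1) ^ Suc k * (x\<^sup>2) ^ Suc k / real (Suc k) - 1 / 2 * ((x\<^sup>2) ^ Suc k / real (Suc k)))))
       sums (arctan x / x * (- 2 * (- ln (1 + x\<^sup>2) - 1 / 2 * (- ln (1 - x\<^sup>2)))))"
      by (intro sums_mult sums_diff sums_sq x)
    moreover have "arctan x / x * (- 2 * (- ln (1 + x\<^sup>2) - 1 / 2 * (- ln (1 - x\<^sup>2)))) = g x"
      by (simp add: g_def)
    moreover have "arctan x / x * (- 2 * ((- 1) ^ Suc k * (x\<^sup>2) ^ Suc k / real (Suc k) - 1 / 2 * ((x\<^sup>2) ^ Suc k / real (Suc k)))) = f k x" for k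
      using x by (simp add: f_eq left_diff_distrib diff_divide_distrib del: power_Suc)
    ultimately show ?thesis by (simp only:)
  qed
  have h: "(\<lambda>x::real. - 3 * ln (1 - x\<^sup>2)) integrable_on {0<..<1}"
    using has_integral_mult_right[OF has_integral_ln_one_minus_square, of "- 3"] by (auto simp: integrable_on_def)
  note swap = integral_sums_dominated[of f I "{0<..<1}", OF int h le g]
  show "g integrable_on {0<..<1}" by (rule swap)
  have s1: "(\<lambda>n. 1 / (real (Suc n))\<^sup>2) sums (pi\<^sup>2 / 6)"
    using inverse_squares_sums by (simp add: add.commute)
  have "(\<lambda>k. ((- 1) ^ Suc k - 1 / 2) / (real (Suc k))\<^sup>2) sums (- (pi\<^sup>2 / 12) - 1 / 2 * (pi\<^sup>2 / 6))"
    using sums_diff[OF sums_alternating_inverse_squares sums_mult[OF s1, of "1 / 2"]]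
    by (simp add: diff_divide_distrib)
  from sums_add[OF swap(2) sums_mult[OF this, of "pi / 4"]]
  show "(\<lambda>k. weight (Suc k) * leib (Suc k)) sums (integral {0<..<1} g - pi ^ 3 / 24)"
    by (simp add: I_def power2_eq_square power3_eq_cube mult.assoc)
qed

subsection \<open>Two integrals with the same series\<close>

lemma isCont_tendsto_within: "isCont F a \<Longrightarrow> (F \<longlongrightarrow> F a) (at a within S)"
  using continuous_at_imp_continuous_at_within continuous_within by blast

text \<open>The value is (2j)!!/(2j+1)!!. These are the coefficients of arcsin s / sqrt(1 - s^2) as
  well as the integrals of odd powers of the cosine, which is why they occur in both
  expansions.\<close>

fun wallis :: "nat \<Rightarrow> real" where
  "wallis 0 = 1"
| "wallis (Suc j) = real (2 * j + 2) / real (2 * j + 3) * wallis j"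

lemma wallis_pos: "wallis j > 0"
  by (induction j) auto

lemma has_integral_wallis: "((\<lambda>y. (1 - y\<^sup>2) ^ j) has_integral wallis j) {0<..<1::real}"
proof (induction j)
  case 0
  show ?case using has_integral_const_real[of 1 0 1] by (simp flip: has_integral_Icc_iff_Ioo)
next
  case (Suc j)
  \<comment> \<open>This function vanishes at 0 and 1, and y^2 = 1 - (1 - y^2) turns its derivative
    into a relation between the powers j and j+1.\<close>
  define F where "F = (\<lambda>y::real. y * (1 - y\<^sup>2) ^ Suc j)"
  have "((\<lambda>y. real (2 * j + 3) * (1 - y\<^sup>2) ^ Suc j - real (2 * j + 2) * (1 - y\<^sup>2) ^ j) has_integral (F 1 - F 0)) {0<..<1}"
  proof (rule has_integral_FTC_Ioo)
    have "isCont F x" for x unfolding F_def by (intro continuous_intros)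
    thus "(F \<longlongrightarrow> F 0) (at_right 0)" "(F \<longlongrightarrow> F 1) (at_left 1)"
      by (simp_all add: continuous_at_imp_continuous_at_within continuous_within[symmetric])
  next
    fix x :: real
    have "((\<lambda>y. 1 - y\<^sup>2) has_real_derivative (- 2 * x)) (at x)"
      by (auto intro!: derivative_eq_intros)
    from DERIV_mult[OF DERIV_ident DERIV_power[OF this, of "Suc j"]]
    have "(F has_real_derivative (1 - x\<^sup>2) ^ Suc j + x * (real (Suc j) * (1 - x\<^sup>2) ^ j * (- 2 * x))) (at x)"
      unfolding F_def by (simp add: mult_ac del: power_Suc)
    also have "(1 - x\<^sup>2) ^ Suc j + x * (real (Suc j) * (1 - x\<^sup>2) ^ j * (- 2 * x)) =
        real (2 * j + 3) * (1 - x\<^sup>2) ^ Suc j - real (2 * j + 2) * (1 - x\<^sup>2) ^ j"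
      by (simp add: power2_eq_square algebra_simps)
    finally show "(F has_real_derivative real (2 * j + 3) * (1 - x\<^sup>2) ^ Suc j - real (2 * j + 2) * (1 - x\<^sup>2) ^ j) (at x)" .
  qed simp
  from has_integral_add[OF this has_integral_mult_right[OF Suc, of "real (2 * j + 2)"]]
  have "((\<lambda>y. real (2 * j + 3) * (1 - y\<^sup>2) ^ Suc j) has_integral real (2 * j + 2) * wallis j) {0<..<1}"
    by (simp add: F_def del: power_Suc)
  from has_integral_mult_right[OF this, of "1 / real (2 * j + 3)"]
  show ?case by (simp del: power_Suc)
qed

lemma DERIV_cos_power:
  "((\<lambda>t. cos t ^ (2 * j + 2)) has_real_derivative - (real (2 * j + 2) * cos t ^ (2 * j + 1) * sin t)) (at t)"
  using DERIV_power[OF DERIV_cos, of "2 * j + 2" t] by (simp add: mult_ac)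

lemma has_integral_cos_power: "((\<lambda>t. cos t ^ (2 * j + 1)) has_integral wallis j) {0<..<pi / 2}"
proof (induction j)
  case 0
  have "(cos has_integral (sin (pi / 2) - sin 0)) {0<..<pi / 2}"
    by (rule has_integral_FTC_Ioo) (auto intro!: derivative_eq_intros isCont_tendsto_within simp del: sin_pi_half sin_zero)
  thus ?case by simp
next
  case (Suc j)
  define F where "F = (\<lambda>t::real. sin t * cos t ^ (2 * j + 2))"
  have "((\<lambda>t. real (2 * j + 3) * cos t ^ (2 * Suc j + 1) - real (2 * j + 2) * cos t ^ (2 * j + 1)) has_integral (F (pi / 2) - F 0)) {0<..<pi / 2}"
  proof (rule has_integral_FTC_Ioo)
    have "isCont F x" for x unfolding F_def by (intro continuous_intros)
    thus "(F \<longlongrightarrow> F 0) (at_right 0)" "(F \<longlongrightarrow> F (pi / 2)) (at_left (pi / 2))"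
      by (simp_all add: continuous_at_imp_continuous_at_within continuous_within[symmetric])
  next
    fix x :: real
    have "(F has_real_derivative cos x * cos x ^ (2 * j + 2) - (sin x)\<^sup>2 * (real (2 * j + 2) * cos x ^ (2 * j + 1))) (at x)"
      unfolding F_def using DERIV_mult[OF DERIV_sin[of x] DERIV_cos_power[of j x]]
      by (simp add: power2_eq_square mult_ac)
    also have "cos x * cos x ^ (2 * j + 2) - (sin x)\<^sup>2 * (real (2 * j + 2) * cos x ^ (2 * j + 1)) =
       real (2 * j + 3) * cos x ^ (2 * Suc j + 1) - real (2 * j + 2) * cos x ^ (2 * j + 1)"
      unfolding sin_squared_eq by (simp add: power2_eq_square algebra_simps)
    finally show "(F has_real_derivative real (2 * j + 3) * cos x ^ (2 * Suc j + 1) - real (2 * j + 2) * cos x ^ (2 * j + 1)) (at x)" .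
  qed simp
  from has_integral_add[OF this has_integral_mult_right[OF Suc, of "real (2 * j + 2)"]]
  have "((\<lambda>t. real (2 * j + 3) * cos t ^ (2 * Suc j + 1)) has_integral real (2 * j + 2) * wallis j) {0<..<pi / 2}"
    by (simp add: F_def power_0_left del: power_Suc)
  from has_integral_mult_right[OF this, of "1 / real (2 * j + 3)"]
  show ?case by (simp del: power_Suc)
qed

section \<open>Half-angle substitution: sin t and cos t as rational functions of x =
  tan(t/2)\<close>

definition tsin :: "real \<Rightarrow> real" where "tsin x = 2 * x / (1 + x\<^sup>2)"
definition tcos :: "real \<Rightarrow> real" where "tcos x = (1 - x\<^sup>2) / (1 + x\<^sup>2)"

lemma one_plus_square_pos: "1 + (x::real)\<^sup>2 > 0"
  by (simp add: add_pos_nonneg)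

lemma tsin_tcos: "(tsin x)\<^sup>2 + (tcos x)\<^sup>2 = 1"
proof -
  have "(2 * x)\<^sup>2 + (1 - x\<^sup>2)\<^sup>2 = (1 + x\<^sup>2)\<^sup>2" by (simp add: power2_eq_square algebra_simps)
  thus ?thesis
    using one_plus_square_pos[of x] by (simp add: tsin_def tcos_def power_divide add_divide_distrib[symmetric])
qed

lemma tsin_pos: "0 < x \<Longrightarrow> 0 < tsin x"
  using one_plus_square_pos[of x] by (simp add: tsin_def)

lemma tcos_pos: "0 < x \<Longrightarrow> x < 1 \<Longrightarrow> 0 < tcos x"
  using one_plus_square_pos[of x] by (simp add: tcos_def power_less_one_iff abs_square_less_1)

lemma DERIV_tsin: "(tsin has_real_derivative 2 * tcos x / (1 + x\<^sup>2)) (at x)"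
proof -
  have "(tsin has_real_derivative (2 * (1 + x\<^sup>2) - 2 * x * (2 * x)) / ((1 + x\<^sup>2) * (1 + x\<^sup>2))) (at x)"
    unfolding tsin_def[abs_def] using one_plus_square_pos[of x]
    by (auto intro!: derivative_eq_intros)
  also have "(2 * (1 + x\<^sup>2) - 2 * x * (2 * x)) / ((1 + x\<^sup>2) * (1 + x\<^sup>2)) = 2 * tcos x / (1 + x\<^sup>2)"
    by (simp add: tcos_def power2_eq_square algebra_simps)
  finally show ?thesis .
qed

lemma DERIV_tcos: "(tcos has_real_derivative - 2 * tsin x / (1 + x\<^sup>2)) (at x)"
proof -
  have "(tcos has_real_derivative (- (2 * x) * (1 + x\<^sup>2) - (1 - x\<^sup>2) * (2 * x)) / ((1 + x\<^sup>2) * (1 + x\<^sup>2))) (at x)"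
    unfolding tcos_def[abs_def] using one_plus_square_pos[of x]
    by (auto intro!: derivative_eq_intros)
  also have "(- (2 * x) * (1 + x\<^sup>2) - (1 - x\<^sup>2) * (2 * x)) / ((1 + x\<^sup>2) * (1 + x\<^sup>2)) = - 2 * tsin x / (1 + x\<^sup>2)"
    by (simp add: tsin_def power2_eq_square algebra_simps)
  finally show ?thesis .
qed

lemma isCont_tsin: "isCont tsin x" and isCont_tcos: "isCont tcos x"
  using DERIV_tsin DERIV_tcos DERIV_isCont by blast+

lemma ln_tcos: "0 < x \<Longrightarrow> x < 1 \<Longrightarrow> ln (tcos x) = ln (1 - x\<^sup>2) - ln (1 + x\<^sup>2)"
proof -
  assume "0 < x" "x < 1"
  hence "1 - x\<^sup>2 > 0" by (simp add: abs_square_less_1)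
  thus ?thesis using one_plus_square_pos[of x] by (simp add: tcos_def ln_div)
qed

text \<open>Write s = \<open>tsin x\<close> and c = \<open>tcos x\<close>. As the coefficients are
  integrals of (1 - y^2)^j, the series is the integral of a geometric sum, namely of 1/(1 - s^2 (1 -
  y^2)) = 1/(c^2 + s^2 y^2). Its primitive is arctan(s y / c)/(s c), and s/c is the tangent of 2
  arctan x.\<close>

lemma sums_wallis_tsin:
  assumes x: "0 < x" "x < 1"
  shows "(\<lambda>j. wallis j * (tsin x) ^ (2 * j)) sums (2 * arctan x / (tsin x * tcos x))"
proof -
  define s c where "s = tsin x" and "c = tcos x"
  have s: "s > 0" and c: "c > 0" and sc: "s\<^sup>2 + c\<^sup>2 = 1"
    using tsin_pos tcos_pos tsin_tcos x by (simp_all add: s_def c_def)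
  have s1: "s\<^sup>2 < 1" using c sc by (metis less_add_same_cancel1 zero_less_power)
  define F where "F = (\<lambda>y. arctan (s * y / c) / (s * c))"
  have geo: "\<bar>s\<^sup>2 * (1 - y\<^sup>2)\<bar> \<le> s\<^sup>2" if "y \<in> {0<..<1}" for y
  proof -
    have "\<bar>1 - y\<^sup>2\<bar> \<le> 1" using that by (simp add: power_le_one)
    thus ?thesis by (simp add: abs_mult mult_left_le)
  qed
  have "(\<lambda>j. s ^ (2 * j) * wallis j) sums integral {0<..<1} (\<lambda>y. 1 / (1 - s\<^sup>2 * (1 - y\<^sup>2)))"
  proof (rule integral_sums_dominated(2))
    show "((\<lambda>y. s ^ (2 * j) * (1 - y\<^sup>2) ^ j) has_integral s ^ (2 * j) * wallis j) {0<..<1}" for j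
      by (rule has_integral_mult_right[OF has_integral_wallis])
    have "(\<lambda>y::real. 1 / (1 - s\<^sup>2)) integrable_on {0..1}" by (rule integrable_const_ivl)
    thus "(\<lambda>y::real. 1 / (1 - s\<^sup>2)) integrable_on {0<..<1}" by (simp add: integrable_on_Icc_iff_Ioo)
    fix y :: real assume y: "y \<in> {0<..<1}"
    have eq: "s ^ (2 * j) * (1 - y\<^sup>2) ^ j = (s\<^sup>2 * (1 - y\<^sup>2)) ^ j" for j
      by (simp add: power_mult power_mult_distrib)
    show "(\<lambda>j. s ^ (2 * j) * (1 - y\<^sup>2) ^ j) sums (1 / (1 - s\<^sup>2 * (1 - y\<^sup>2)))"
      unfolding eq using geo[OF y] s1 by (intro geometric_sums) simp
    show "\<bar>\<Sum>j<n. s ^ (2 * j) * (1 - y\<^sup>2) ^ j\<bar> \<le> 1 / (1 - s\<^sup>2)" for n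
    proof -
      have "\<bar>\<Sum>j<n. s ^ (2 * j) * (1 - y\<^sup>2) ^ j\<bar> \<le> (\<Sum>j<n. (s\<^sup>2) ^ j)"
        unfolding eq by (intro order_trans[OF sum_abs] sum_mono) (auto simp: power_abs intro!: power_mono geo[OF y])
      also have "\<dots> \<le> 1 / (1 - s\<^sup>2)"
        using geometric_sums[of "s\<^sup>2"] s1 by (intro sum_le_suminf[THEN order_trans]) (auto simp: sums_iff)
      finally show ?thesis .
    qed
  qed
  also have "((\<lambda>y. 1 / (1 - s\<^sup>2 * (1 - y\<^sup>2))) has_integral (F 1 - F 0)) {0<..<1}"
  proof (rule has_integral_FTC_Ioo)
    have "isCont F y" for y unfolding F_def using s c by (intro continuous_intros) auto
    thus "(F \<longlongrightarrow> F 0) (at_right 0)" "(F \<longlongrightarrow> F 1) (at_left 1)"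
      by (simp_all add: continuous_at_imp_continuous_at_within continuous_within[symmetric])
  next
    fix y :: real
    have pos: "c\<^sup>2 + s\<^sup>2 * y\<^sup>2 > 0" using c by (simp add: add_pos_nonneg)
    have "(F has_real_derivative (s / c) * inverse (1 + (s * y / c)\<^sup>2) / (s * c)) (at y)"
      unfolding F_def using s c by (auto intro!: derivative_eq_intros)
    also have "(s / c) * inverse (1 + (s * y / c)\<^sup>2) / (s * c) = 1 / (c\<^sup>2 + s\<^sup>2 * y\<^sup>2)"
      using s c pos by (simp add: divide_simps power2_eq_square)
    also have "c\<^sup>2 + s\<^sup>2 * y\<^sup>2 = 1 - s\<^sup>2 * (1 - y\<^sup>2)"
      using sc by (simp add: algebra_simps)
    finally show "(F has_real_derivative 1 / (1 - s\<^sup>2 * (1 - y\<^sup>2))) (at y)" .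
  qed simp
  hence "integral {0<..<1} (\<lambda>y. 1 / (1 - s\<^sup>2 * (1 - y\<^sup>2))) = F 1 - F 0"
    by (rule integral_unique)
  also have "s * 1 / c = 2 * x / (1 - x\<^sup>2)"
    using one_plus_square_pos[of x] by (simp add: s_def c_def tsin_def tcos_def)
  hence "F 1 - F 0 = 2 * arctan x / (s * c)"
    using arctan_double[of x] x by (simp add: F_def)
  finally show ?thesis by (simp add: s_def c_def mult.commute)
qed

text \<open>The last factor of the integrand is ds/dx for s = \<open>tsin x\<close>, so in the
  variable s this is half the integral of s^(2j) ln(1 - s^2) over (0,1).\<close>

lemma has_integral_tsin_power_ln_tcos:
  "((\<lambda>x. tsin x ^ (2 * j) * ln (tcos x) * (2 * tcos x / (1 + x\<^sup>2))) has_integral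
     (ln 2 - odd_harm (Suc j)) / real (2 * j + 1)) {0<..<1}"
proof (induction j)
  case 0
  define F where "F = (\<lambda>x. (- (1 - tsin x) * ln (1 - tsin x) + (1 + tsin x) * ln (1 + tsin x)) / 2 - tsin x)"
  have "((\<lambda>x. ln (tcos x) * (2 * tcos x / (1 + x\<^sup>2))) has_integral (F 1 - F 0)) {0<..<1}"
  proof (rule has_integral_FTC_Ioo)
    show "(F \<longlongrightarrow> F 0) (at_right 0)" unfolding F_def tsin_def by real_asymp
    show "(F \<longlongrightarrow> F 1) (at_left 1)" unfolding F_def tsin_def by (simp, real_asymp)
  next
    fix x :: real assume x: "0 < x" "x < 1"
    define d where "d = 2 * tcos x / (1 + x\<^sup>2)"
    have s: "0 < tsin x" using tsin_pos x by simp
    have c: "0 < tcos x" using tcos_pos x by simp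
    have cc: "(tcos x)\<^sup>2 = (1 - tsin x) * (1 + tsin x)"
      using tsin_tcos[of x] by (simp add: power2_eq_square algebra_simps)
    hence "(1 - tsin x) * (1 + tsin x) > 0" using c by (metis zero_less_power)
    hence s1: "1 - tsin x > 0" using s by (simp add: zero_less_mult_iff)
    have ln: "2 * ln (tcos x) = ln (1 - tsin x) + ln (1 + tsin x)"
    proof -
      have "2 * ln (tcos x) = ln ((tcos x)\<^sup>2)" using c by (simp add: ln_realpow)
      also have "\<dots> = ln (1 - tsin x) + ln (1 + tsin x)"
        unfolding cc using s s1 by (intro ln_mult_pos) auto
      finally show ?thesis .
    qed
    note D = DERIV_tsin[of x, folded d_def]
    have "((\<lambda>x. (1 - tsin x) * ln (1 - tsin x)) has_real_derivative (- d * ln (1 - tsin x) - d)) (at x)"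
      using s1 by (auto intro!: derivative_eq_intros D)
    moreover have "((\<lambda>x. (1 + tsin x) * ln (1 + tsin x)) has_real_derivative (d * ln (1 + tsin x) + d)) (at x)"
      using s by (auto intro!: derivative_eq_intros D)
    ultimately have "((\<lambda>x. (- ((1 - tsin x) * ln (1 - tsin x)) + (1 + tsin x) * ln (1 + tsin x)) / 2 - tsin x)
       has_real_derivative ((- (- d * ln (1 - tsin x) - d) + (d * ln (1 + tsin x) + d)) / 2 - d)) (at x)"
      by (intro DERIV_diff DERIV_cdivide DERIV_add DERIV_minus D)
    also have "(- (- d * ln (1 - tsin x) - d) + (d * ln (1 + tsin x) + d)) / 2 - d = d * (ln (1 - tsin x) + ln (1 + tsin x)) / 2"
      by (simp add: field_simps)
    also have "\<dots> = ln (tcos x) * d" unfolding ln[symmetric] by simp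
    finally show "(F has_real_derivative ln (tcos x) * (2 * tcos x / (1 + x\<^sup>2))) (at x)"
      by (simp only: F_def d_def mult_minus_left)
  qed simp
  moreover have "F 1 - F 0 = ln 2 - odd_harm (Suc 0)"
    by (simp add: F_def tsin_def odd_harm_def)
  ultimately show ?case by simp
next
  case (Suc j)
  define f where "f = (\<lambda>j x. tsin x ^ (2 * j) * ln (tcos x) * (2 * tcos x / (1 + x\<^sup>2)))"
  \<comment> \<open>The grouping isolates \<open>tcos x * ln (tcos x)\<close>, whose limit at x = 1
    is 0. The last summand removes the power of s that appears when the logarithm is differentiated;
    its boundary value -1/(2j+3) is the new term of \<open>odd_harm\<close>.\<close>
  define F where "F = (\<lambda>x. - (tsin x ^ (2 * j + 1) * (tcos x * (tcos x * ln (tcos x)))) - tsin x ^ (2 * j + 3) / real (2 * j + 3))"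
  have xlnx: "((\<lambda>x::real. x * ln x) \<longlongrightarrow> 0 * ln 0) (at_right 0)" by (simp, real_asymp)
  have "((\<lambda>x. real (2 * j + 3) * f (Suc j) x - real (2 * j + 1) * f j x) has_integral (F 1 - F 0)) {0<..<1}"
  proof (rule has_integral_FTC_Ioo)
    have "isCont F 0"
      unfolding F_def by (intro continuous_intros isCont_tsin isCont_tcos) (auto simp: tcos_def)
    thus "(F \<longlongrightarrow> F 0) (at_right 0)"
      by (simp add: continuous_at_imp_continuous_at_within continuous_within[symmetric])
    have "filterlim tcos (at_right 0) (at_left 1)" unfolding tcos_def by real_asymp
    from filterlim_compose[OF xlnx this]
    have 1: "((\<lambda>x. tcos x * ln (tcos x)) \<longlongrightarrow> tcos 1 * ln (tcos 1)) (at_left 1)"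
      by (simp add: tcos_def)
    have 2: "(tcos \<longlongrightarrow> tcos 1) (at_left 1)" "(tsin \<longlongrightarrow> tsin 1) (at_left 1)"
      using isCont_tcos[of 1] isCont_tsin[of 1]
      by (simp_all add: continuous_at_imp_continuous_at_within continuous_within[symmetric])
    show "(F \<longlongrightarrow> F 1) (at_left 1)"
      unfolding F_def by (intro tendsto_intros 1 2) auto
  next
    fix x :: real assume x: "0 < x" "x < 1"
    define d where "d = 2 * tcos x / (1 + x\<^sup>2)"
    define s c L where "s = tsin x" and "c = tcos x" and "L = ln (tcos x)"
    have c: "0 < c" using tcos_pos x by (simp add: c_def)
    have s: "0 < s" using tsin_pos x by (simp add: s_def)
    have s2: "s\<^sup>2 = 1 - c\<^sup>2" using tsin_tcos[of x] by (simp add: s_def c_def)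
    have Ds: "(tsin has_real_derivative d) (at x)" using DERIV_tsin d_def by simp
    have Dc: "(tcos has_real_derivative - s * d / c) (at x)"
    proof -
      have "- s * d / c = - 2 * tsin x / (1 + x\<^sup>2)" using c by (simp add: d_def s_def c_def)
      thus ?thesis using DERIV_tcos[of x] by simp
    qed
    have Dsn: "((\<lambda>x. tsin x ^ (2 * j + 1)) has_real_derivative real (2 * j + 1) * s ^ (2 * j) * d) (at x)"
      using DERIV_power[OF Ds, of "2 * j + 1"] by (simp add: s_def mult_ac)
    have Dsn3: "((\<lambda>x. tsin x ^ (2 * j + 3) / real (2 * j + 3)) has_real_derivative s ^ (2 * j + 2) * d) (at x)"
      using DERIV_cdivide[OF DERIV_power[OF Ds, of "2 * j + 3"], of "real (2 * j + 3)"] by (simp add: s_def mult_ac)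
    have Dln: "((\<lambda>x. ln (tcos x)) has_real_derivative - s * d / c\<^sup>2) (at x)"
      using DERIV_chain2[OF DERIV_ln[of "tcos x"] Dc] c by (simp add: c_def power2_eq_square inverse_eq_divide)
    have "(F has_real_derivative
       - (real (2 * j + 1) * s ^ (2 * j) * d * (c * (c * L))
          + (- s * d / c * (c * L) + (- s * d / c * L + - s * d / c\<^sup>2 * c) * c) * s ^ (2 * j + 1))
       - s ^ (2 * j + 2) * d) (at x)"
      unfolding F_def s_def c_def L_def
      by (intro DERIV_diff DERIV_minus DERIV_mult Dsn[unfolded s_def] Dsn3[unfolded s_def] Dc[unfolded s_def c_def] Dln[unfolded s_def c_def])
    also have "- (real (2 * j + 1) * s ^ (2 * j) * d * (c * (c * L))
          + (- s * d / c * (c * L) + (- s * d / c * L + - s * d / c\<^sup>2 * c) * c) * s ^ (2 * j + 1))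
       - s ^ (2 * j + 2) * d =
       - (real (2 * j + 1) * s ^ (2 * j) * d * c\<^sup>2 * L) + 2 * s * d * L * s ^ (2 * j + 1) + (s * d * s ^ (2 * j + 1) - s ^ (2 * j + 2) * d)"
      using c by (simp add: power2_eq_square field_simps)
    also have "s * d * s ^ (2 * j + 1) - s ^ (2 * j + 2) * d = 0" by simp
    also have "c\<^sup>2 = 1 - s\<^sup>2" using s2 by simp
    also have "- (real (2 * j + 1) * s ^ (2 * j) * d * (1 - s\<^sup>2) * L) + 2 * s * d * L * s ^ (2 * j + 1) + 0 =
       real (2 * j + 3) * (s ^ (2 * Suc j) * L * d) - real (2 * j + 1) * (s ^ (2 * j) * L * d)"
      by (simp add: power2_eq_square algebra_simps)
    finally show "(F has_real_derivative real (2 * j + 3) * f (Suc j) x - real (2 * j + 1) * f j x) (at x)"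
      unfolding f_def d_def s_def c_def L_def by simp
  qed simp
  moreover have "(f j has_integral (ln 2 - odd_harm (Suc j)) / real (2 * j + 1)) {0<..<1}"
    unfolding f_def by (rule Suc)
  from has_integral_mult_right[OF this, of "real (2 * j + 1)"]
  have "((\<lambda>x. real (2 * j + 1) * f j x) has_integral (ln 2 - odd_harm (Suc j))) {0<..<1}"
    by simp
  ultimately have "((\<lambda>x. real (2 * j + 3) * f (Suc j) x - real (2 * j + 1) * f j x + real (2 * j + 1) * f j x)
      has_integral (F 1 - F 0 + (ln 2 - odd_harm (Suc j)))) {0<..<1}"
    by (rule has_integral_add)
  hence "((\<lambda>x. real (2 * j + 3) * f (Suc j) x) has_integral (F 1 - F 0 + (ln 2 - odd_harm (Suc j)))) {0<..<1}"
    by simp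
  from has_integral_mult_right[OF this, of "1 / real (2 * j + 3)"]
  have "(f (Suc j) has_integral (F 1 - F 0 + (ln 2 - odd_harm (Suc j))) / real (2 * j + 3)) {0<..<1}"
    by simp
  moreover have "F 1 - F 0 + (ln 2 - odd_harm (Suc j)) = ln 2 - odd_harm (Suc (Suc j))"
    by (simp add: F_def tsin_def tcos_def odd_harm_Suc[of "Suc j"] add_ac)
  ultimately show ?case by (simp add: f_def add.commute)
qed


text \<open>With s = \<open>tsin x\<close> one has ds/dx = tsin x * tcos x / x. Hence ln(tcos x)
  ds/dx times the series of \<open>sums_wallis_tsin\<close> is exactly 2 g.\<close>

lemma sums_integral_arctan_ln_tcos:
  defines "g \<equiv> \<lambda>x. arctan x / x * ln (tcos x)"
  shows "g integrable_on {0<..<1}"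
    and "(\<lambda>j. wallis j * ((ln 2 - odd_harm (Suc j)) / real (2 * j + 1))) sums (2 * integral {0<..<1} g)"
proof -
  define D where "D x = 2 * tcos x / (1 + x\<^sup>2)" for x
  define f where "f j x = wallis j * (tsin x ^ (2 * j) * ln (tcos x) * D x)" for j x
  have f_eq: "f j x = ln (tcos x) * D x * (wallis j * tsin x ^ (2 * j))" for j x
    by (simp add: f_def)
  have total: "ln (tcos x) * D x * (2 * arctan x / (tsin x * tcos x)) = 2 * g x" if "0 < x" "x < 1" for x
  proof -
    have c: "tcos x > 0" by (rule tcos_pos) fact+
    have "tsin x * (1 + x\<^sup>2) = 2 * x" using one_plus_square_pos[of x] by (simp add: tsin_def)
    hence "D x * (2 * arctan x / (tsin x * tcos x)) = 2 * arctan x * 2 / (2 * x)"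
      using c by (simp add: D_def mult_ac)
    hence "D x * (2 * arctan x / (tsin x * tcos x)) = 2 * (arctan x / x)" by simp
    thus ?thesis by (simp only: g_def mult.assoc) (simp only: mult_ac)
  qed
  have int: "(f j has_integral (wallis j * ((ln 2 - odd_harm (Suc j)) / real (2 * j + 1)))) {0<..<1}" for j
    unfolding f_def D_def by (rule has_integral_mult_right[OF has_integral_tsin_power_ln_tcos])
  have sums: "(\<lambda>j. f j x) sums (2 * g x)" if x: "x \<in> {0<..<1}" for x
    unfolding f_eq total[symmetric, of x, OF x[unfolded greaterThanLessThan_iff, THEN conjunct1] x[unfolded greaterThanLessThan_iff, THEN conjunct2]]
    using x by (intro sums_mult sums_wallis_tsin) auto
  \<comment> \<open>For fixed x all terms have the sign of ln(tcos x), so the absolute value of a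
    partial sum is at most that of the full sum.\<close>
  have le: "\<bar>\<Sum>j<n. f j x\<bar> \<le> 2 * ln 2 - 2 * ln (1 - x\<^sup>2)" if x: "x \<in> {0<..<1}" for n x
  proof -
    have x': "0 < x" "x < 1" using x by auto
    have c: "tcos x > 0" using tcos_pos[OF x'] .
    have "x\<^sup>2 < 1" using x' by (simp add: abs_square_less_1)
    hence "ln (1 - x\<^sup>2) \<le> 0" by simp
    moreover have "0 \<le> ln (1 + x\<^sup>2)" "ln (1 + x\<^sup>2) \<le> ln 2"
      using \<open>x\<^sup>2 < 1\<close> one_plus_square_pos[of x] by (simp_all add: ln_ge_zero)
    ultimately have ln: "ln (tcos x) \<le> 0" "- ln (tcos x) \<le> ln 2 - ln (1 - x\<^sup>2)"
      unfolding ln_tcos[OF x'] by linarith+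
    have D: "D x \<ge> 0" using c one_plus_square_pos[of x] by (simp add: D_def)
    define T where "T = (\<Sum>j<n. wallis j * tsin x ^ (2 * j))"
    have T: "0 \<le> T" unfolding T_def using wallis_pos tsin_pos[of x] x' by (intro sum_nonneg) (auto intro!: mult_nonneg_nonneg less_imp_le)
    have T': "T \<le> 2 * arctan x / (tsin x * tcos x)"
      unfolding T_def using sums_wallis_tsin[OF x'] wallis_pos tsin_pos[of x] x'
      by (intro sum_le_suminf[THEN order_trans]) (auto simp: sums_iff intro!: mult_nonneg_nonneg less_imp_le)
    have "\<bar>\<Sum>j<n. f j x\<bar> = - ln (tcos x) * D x * T"
      unfolding f_eq sum_distrib_left[symmetric] T_def[symmetric] using ln D T by (simp add: abs_mult)
    also have "\<dots> \<le> - ln (tcos x) * D x * (2 * arctan x / (tsin x * tcos x))"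
      using ln D T' by (intro mult_left_mono mult_nonneg_nonneg) auto
    also have "\<dots> = 2 * (arctan x / x * (- ln (tcos x)))"
      using total[OF x'] by (simp add: g_def)
    also have "\<dots> \<le> 2 * (1 * (- ln (tcos x)))"
      using arctan_le_self[of x] x' ln by (intro mult_left_mono mult_right_mono) auto
    also have "\<dots> \<le> 2 * ln 2 - 2 * ln (1 - x\<^sup>2)" using ln by simp
    finally show ?thesis .
  qed
  have h: "(\<lambda>x::real. 2 * ln 2 - 2 * ln (1 - x\<^sup>2)) integrable_on {0<..<1}"
  proof -
    have "(\<lambda>x::real. 2 * ln 2 :: real) integrable_on {0<..<1}"
      by (rule integrable_on_Icc_iff_Ioo[THEN iffD1, OF integrable_const_ivl])
    moreover have "(\<lambda>x::real. 2 * ln (1 - x\<^sup>2)) integrable_on {0<..<1}"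
      using has_integral_mult_right[OF has_integral_ln_one_minus_square, of 2] by (auto simp: integrable_on_def)
    ultimately show ?thesis by (rule integrable_diff)
  qed
  note swap = integral_sums_dominated[OF int h le sums]
  have "(\<lambda>x. 2 * g x) integrable_on {0<..<1}" by (rule swap(1))
  hence "(\<lambda>x. 1 / 2 * (2 * g x)) integrable_on {0<..<1}"
    by (rule integrable_on_mult_right)
  thus "g integrable_on {0<..<1}" by simp
  have "(\<lambda>j. wallis j * ((ln 2 - odd_harm (Suc j)) / real (2 * j + 1))) sums integral {0<..<1} (\<lambda>x. 2 * g x)"
    by (rule swap(2))
  thus "(\<lambda>j. wallis j * ((ln 2 - odd_harm (Suc j)) / real (2 * j + 1))) sums (2 * integral {0<..<1} g)"
    by simp
qed

section \<open>The expansion of T in powers of the cosine\<close>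

lemma has_integral_cos_power_ln_sin:
  "((\<lambda>t. cos t ^ (2 * j + 1) * ln (2 * sin t)) has_integral wallis j * (ln 2 - odd_harm (Suc j))) {0<..<pi / 2}"
proof (induction j)
  case 0
  define F where "F = (\<lambda>t::real. sin t * ln (2 * sin t) - sin t)"
  have "((\<lambda>t. cos t * ln (2 * sin t)) has_integral (F (pi / 2) - F 0)) {0<..<pi / 2}"
  proof (rule has_integral_FTC_Ioo)
    show "(F \<longlongrightarrow> F 0) (at_right 0)" unfolding F_def by (simp, real_asymp)
    have "isCont F (pi / 2)" unfolding F_def by (intro continuous_intros) auto
    thus "(F \<longlongrightarrow> F (pi / 2)) (at_left (pi / 2))" by (rule isCont_tendsto_within)
  next
    fix t :: real assume t: "0 < t" "t < pi / 2"
    hence "sin t > 0" by (intro sin_gt_zero) auto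
    thus "(F has_real_derivative cos t * ln (2 * sin t)) (at t)"
      unfolding F_def by (auto intro!: derivative_eq_intros)
  qed simp
  thus ?case by (simp add: F_def odd_harm_def)
next
  case (Suc j)
  define f where "f = (\<lambda>j (t::real). cos t ^ (2 * j + 1) * ln (2 * sin t))"
  \<comment> \<open>\<open>F\<close> vanishes at both ends. Differentiating its logarithm leaves an
    extra cos^(2j+3), whose integral \<open>wallis (Suc j)\<close> yields the new harmonic term
    1/(2j+3).\<close>
  define F where "F = (\<lambda>t::real. cos t ^ (2 * j + 2) * (sin t * ln (2 * sin t)))"
  have "((\<lambda>t. real (2 * j + 3) * f (Suc j) t - real (2 * j + 2) * f j t + cos t ^ (2 * Suc j + 1))
      has_integral (F (pi / 2) - F 0)) {0<..<pi / 2}"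
  proof (rule has_integral_FTC_Ioo)
    have "((\<lambda>t::real. sin t * ln (2 * sin t)) \<longlongrightarrow> 0) (at_right 0)" by real_asymp
    moreover have "((\<lambda>t::real. cos t ^ (2 * j + 2)) \<longlongrightarrow> cos 0 ^ (2 * j + 2)) (at_right 0)"
      by (intro tendsto_intros)
    ultimately have "(F \<longlongrightarrow> cos 0 ^ (2 * j + 2) * 0) (at_right 0)"
      unfolding F_def by (intro tendsto_mult)
    thus "(F \<longlongrightarrow> F 0) (at_right 0)" by (simp add: F_def)
    have "isCont F (pi / 2)" unfolding F_def by (intro continuous_intros) auto
    thus "(F \<longlongrightarrow> F (pi / 2)) (at_left (pi / 2))" by (rule isCont_tendsto_within)
  next
    fix t :: real assume t: "0 < t" "t < pi / 2"
    hence s: "sin t > 0" by (intro sin_gt_zero) auto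
    define L where "L = ln (2 * sin t)"
    have "((\<lambda>t. sin t * ln (2 * sin t)) has_real_derivative cos t * L + cos t) (at t)"
      using s by (auto intro!: derivative_eq_intros simp: L_def)
    moreover have "((\<lambda>t. cos t ^ (2 * j + 2)) has_real_derivative - (real (2 * j + 2) * cos t ^ (2 * j + 1) * sin t)) (at t)"
      by (rule DERIV_cos_power)
    ultimately have "(F has_real_derivative - (real (2 * j + 2) * cos t ^ (2 * j + 1) * sin t) * (sin t * L)
        + (cos t * L + cos t) * cos t ^ (2 * j + 2)) (at t)"
      unfolding F_def L_def by (rule DERIV_mult[rotated])
    also have "- (real (2 * j + 2) * cos t ^ (2 * j + 1) * sin t) * (sin t * L) + (cos t * L + cos t) * cos t ^ (2 * j + 2)
        = - (real (2 * j + 2) * cos t ^ (2 * j + 1) * (sin t)\<^sup>2 * L) + (cos t * L + cos t) * cos t ^ (2 * j + 2)"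
      by (simp add: power2_eq_square)
    also have "\<dots> = real (2 * j + 3) * (cos t ^ (2 * Suc j + 1) * L) - real (2 * j + 2) * (cos t ^ (2 * j + 1) * L) + cos t ^ (2 * Suc j + 1)"
      unfolding sin_squared_eq by (simp add: power2_eq_square algebra_simps)
    finally show "(F has_real_derivative real (2 * j + 3) * f (Suc j) t - real (2 * j + 2) * f j t + cos t ^ (2 * Suc j + 1)) (at t)"
      unfolding f_def L_def .
  qed simp
  moreover have "(f j has_integral wallis j * (ln 2 - odd_harm (Suc j))) {0<..<pi / 2}"
    unfolding f_def by (rule Suc)
  from has_integral_diff[OF has_integral_mult_right[OF this, of "real (2 * j + 2)"] has_integral_cos_power[of "Suc j"]]
  have "((\<lambda>t. real (2 * j + 2) * f j t - cos t ^ (2 * Suc j + 1)) has_integral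
      (real (2 * j + 2) * (wallis j * (ln 2 - odd_harm (Suc j))) - wallis (Suc j))) {0<..<pi / 2}" .
  ultimately have "((\<lambda>t. real (2 * j + 3) * f (Suc j) t - real (2 * j + 2) * f j t + cos t ^ (2 * Suc j + 1)
        + (real (2 * j + 2) * f j t - cos t ^ (2 * Suc j + 1))) has_integral
      (F (pi / 2) - F 0 + (real (2 * j + 2) * (wallis j * (ln 2 - odd_harm (Suc j))) - wallis (Suc j)))) {0<..<pi / 2}"
    by (rule has_integral_add)
  from has_integral_mult_right[OF this, of "1 / real (2 * j + 3)"]
  have "(f (Suc j) has_integral
      (real (2 * j + 2) * (wallis j * (ln 2 - odd_harm (Suc j))) - wallis (Suc j)) / real (2 * j + 3)) {0<..<pi / 2}"
    by (simp add: F_def del: wallis.simps power_Suc)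
  also have "(real (2 * j + 2) * (wallis j * (ln 2 - odd_harm (Suc j))) - wallis (Suc j)) / real (2 * j + 3)
      = wallis (Suc j) * (ln 2 - odd_harm (Suc (Suc j)))"
    by (simp add: odd_harm_Suc[of "Suc j"] field_simps)
  finally show ?case by (simp only: f_def)
qed

text \<open>The single function 2 - ln t is to dominate both logarithms of T, and later the real
  parts of the logarithms on the arcs. The bounds rest on t/2 <= tan(t/2) <= 1 and t <= 2 sin t <=
  2; the constant 2 leaves room because ln 2 and ln t are at most 1.\<close>

lemma half_angle_bounds:
  assumes t: "0 < t" "t < pi / 2"
  shows "0 \<le> - ln (tan (t / 2))" "- ln (tan (t / 2)) \<le> 2 - ln t" "\<bar>ln (2 * sin t)\<bar> \<le> 2 - ln t" "0 \<le> 2 - ln t"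
    "ln t \<le> ln (2 * sin t)"
proof -
  define u where "u = t / 2"
  have u: "0 < u" "u < pi / 4" "t = 2 * u" using t by (auto simp: u_def)
  have tan_ge: "u \<le> tan u"
    using arctan_le_self[of "tan u"] u arctan_tan[of u] tan_gt_zero[of u] by simp
  have tan_le: "tan u \<le> 1"
    using tan_monotone[of u "pi / 4"] u by (simp add: tan_45)
  have "ln t \<le> ln 2" using t pi_less_4 by simp
  moreover have "ln (2::real) \<le> 1" using ln2_le_25_over_36 by simp
  ultimately have ln: "ln t \<le> 1" "ln (2::real) \<le> 1" by simp_all
  show "0 \<le> - ln (tan (t / 2))" using tan_ge tan_le u by (simp add: u_def[symmetric])
  have "ln u \<le> ln (tan u)" using u tan_ge by simp
  moreover have "ln t = ln 2 + ln u" using u by (simp add: ln_mult)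
  ultimately show "- ln (tan (t / 2)) \<le> 2 - ln t"
    using ln u by (simp add: u_def[symmetric])
  have cu: "cos u > 0" using u by (intro cos_gt_zero) auto
  \<comment> \<open>2 sin t = 4 sin u cos u >= 4 u (cos u)^2, and (cos u)^2 >= 1/2 since cos(2u) >
    0.\<close>
  have "t \<le> 2 * sin t"
  proof -
    have "u * cos u \<le> sin u" using tan_ge cu by (simp add: tan_def field_simps)
    hence "4 * (u * cos u * cos u) \<le> 4 * (sin u * cos u)" using cu by (intro mult_left_mono mult_right_mono) auto
    also have "\<dots> = 2 * sin t" by (simp add: u sin_double)
    finally have "4 * u * (cos u)\<^sup>2 \<le> 2 * sin t" by (simp add: power2_eq_square mult_ac)
    moreover have "(cos u)\<^sup>2 \<ge> 1 / 2"
    proof -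
      have "cos t > 0" using t by (intro cos_gt_zero) auto
      thus ?thesis by (simp add: u cos_double_cos)
    qed
    hence "4 * u * (1 / 2) \<le> 4 * u * (cos u)\<^sup>2" using u by (intro mult_left_mono) auto
    ultimately show ?thesis using u by linarith
  qed
  hence "ln t \<le> ln (2 * sin t)" using t by simp
  thus "ln t \<le> ln (2 * sin t)" .
  moreover have "ln (2 * sin t) \<le> ln 2" using \<open>t \<le> 2 * sin t\<close> t sin_le_one[of t] by (subst ln_le_cancel_iff) auto
  ultimately show "\<bar>ln (2 * sin t)\<bar> \<le> 2 - ln t" using ln by simp
  show "0 \<le> 2 - ln t" using ln by simp
qed

lemma integrable_ln_square: "(\<lambda>t. (2 - ln t)\<^sup>2) integrable_on {0<..<pi / 2}"
proof -
  define F where "F = (\<lambda>t::real. t * (ln t)\<^sup>2 - 6 * (t * ln t) + 10 * t)"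
  have "((\<lambda>t. (2 - ln t)\<^sup>2) has_integral (F (pi / 2) - F 0)) {0<..<pi / 2}"
  proof (rule has_integral_FTC_Ioo)
    show "(F \<longlongrightarrow> F 0) (at_right 0)" unfolding F_def by (simp, real_asymp)
    have "isCont F (pi / 2)" unfolding F_def by (intro continuous_intros) auto
    thus "(F \<longlongrightarrow> F (pi / 2)) (at_left (pi / 2))" by (rule isCont_tendsto_within)
  next
    fix t :: real assume t: "0 < t"
    thus "(F has_real_derivative (2 - ln t)\<^sup>2) (at t)"
      unfolding F_def by (auto intro!: derivative_eq_intros simp: power2_eq_square algebra_simps)
  qed simp
  thus ?thesis by (rule has_integral_integrable)
qed

text \<open>Here -ln tan(t/2) = artanh(cos t) is expanded in odd powers of cos t. The resulting
  terms are those of \<open>sums_integral_arctan_ln_tcos\<close> with exchanged roles: there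
  \<open>wallis j\<close> is the coefficient and 1/(2j+1) comes from the integral, here 1/(2j+1) is
  the coefficient and \<open>wallis j\<close> comes from the integral.\<close>

lemma sums_integral_ln_tan_ln_sin:
  defines "g \<equiv> \<lambda>t. - ln (tan (t / 2)) * ln (2 * sin t)"
  shows "g integrable_on {0<..<pi / 2}"
    and "(\<lambda>j. wallis j * ((ln 2 - odd_harm (Suc j)) / real (2 * j + 1))) sums integral {0<..<pi / 2} g"
proof -
  define f where "f j t = 1 / real (2 * j + 1) * (cos t ^ (2 * j + 1) * ln (2 * sin t))" for j t
  have int: "(f j has_integral (wallis j * ((ln 2 - odd_harm (Suc j)) / real (2 * j + 1)))) {0<..<pi / 2}" for j
  proof -
    have "wallis j * ((ln 2 - odd_harm (Suc j)) / real (2 * j + 1)) =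
        1 / real (2 * j + 1) * (wallis j * (ln 2 - odd_harm (Suc j)))" by simp
    thus ?thesis
      unfolding f_def by (simp only: has_integral_mult_right[OF has_integral_cos_power_ln_sin])
  qed
  have f_eq: "f j t = ln (2 * sin t) * (cos t ^ (2 * j + 1) / real (2 * j + 1))" for j t
    by (simp add: f_def)
  have artanh: "(\<lambda>j. cos t ^ (2 * j + 1) / real (2 * j + 1)) sums (- ln (tan (t / 2)))"
    if t: "t \<in> {0<..<pi / 2}" for t
  proof -
    define u where "u = t / 2"
    have u: "0 < u" "u < pi / 4" "t = 2 * u" using t by (auto simp: u_def)
    have s: "sin u > 0" using u by (intro sin_gt_zero) auto
    have c: "cos u > 0" using u by (intro cos_gt_zero) auto
    \<comment> \<open>For x = cot^2 u the argument (x-1)/(x+1) of the quadratic logarithm series is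
      cos(2u).\<close>
    define x where "x = (cos u / sin u)\<^sup>2"
    have x: "x > 0" using s c by (simp add: x_def)
    have "(x - 1) / (x + 1) = ((cos u)\<^sup>2 - (sin u)\<^sup>2) / ((cos u)\<^sup>2 + (sin u)\<^sup>2)"
      using s by (simp add: x_def power_divide divide_simps)
    hence ratio: "(x - 1) / (x + 1) = cos t" by (simp add: u cos_double)
    have "ln x = 2 * ln (inverse (tan u))"
      using s c by (simp add: x_def ln_realpow tan_def)
    also have "\<dots> = 2 * (- ln (tan u))"
      using tan_gt_zero[of u] u by (simp add: ln_inverse)
    finally have ln_x: "ln x = 2 * (- ln (tan u))" .
    have "(\<lambda>n. 2 * (cos t ^ (2 * n + 1) / real (2 * n + 1))) sums (2 * (- ln (tan u)))"
      using ln_series_quadratic[OF x] unfolding ratio ln_x by simp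
    from sums_mult[OF this, of "1 / 2"] show ?thesis by (simp add: u_def)
  qed
  have sums: "(\<lambda>j. f j t) sums g t" if "t \<in> {0<..<pi / 2}" for t
    unfolding f_eq g_def using sums_mult[OF artanh[OF that], of "ln (2 * sin t)"] by (simp add: mult.commute)
  have le: "\<bar>\<Sum>j<n. f j t\<bar> \<le> (2 - ln t)\<^sup>2" if t: "t \<in> {0<..<pi / 2}" for n t
  proof -
    have b: "0 \<le> - ln (tan (t / 2))" "- ln (tan (t / 2)) \<le> 2 - ln t" "\<bar>ln (2 * sin t)\<bar> \<le> 2 - ln t" "0 \<le> 2 - ln t"
      using half_angle_bounds[of t] t by auto
    have cos: "cos t \<ge> 0" using t by (intro cos_ge_zero) auto
    have "(\<Sum>j<n. cos t ^ (2 * j + 1) / real (2 * j + 1)) \<le> - ln (tan (t / 2))"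
      using artanh[OF t] cos by (intro sum_le_suminf[THEN order_trans]) (auto simp: sums_iff)
    moreover have "0 \<le> (\<Sum>j<n. cos t ^ (2 * j + 1) / real (2 * j + 1))" using cos by (intro sum_nonneg) auto
    ultimately have "\<bar>ln (2 * sin t)\<bar> * \<bar>\<Sum>j<n. cos t ^ (2 * j + 1) / real (2 * j + 1)\<bar> \<le> (2 - ln t) * (2 - ln t)"
      using b by (intro mult_mono) auto
    thus ?thesis unfolding f_eq sum_distrib_left[symmetric] by (simp add: abs_mult power2_eq_square)
  qed
  note swap = integral_sums_dominated[OF int integrable_ln_square le sums]
  show "g integrable_on {0<..<pi / 2}" by (rule swap)
  show "(\<lambda>j. wallis j * ((ln 2 - odd_harm (Suc j)) / real (2 * j + 1))) sums integral {0<..<pi / 2} g"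
    by (rule swap)
qed

subsection \<open>Contour integration over the quarter disc\<close>

definition log_sq_diff :: "complex \<Rightarrow> complex" where
  "log_sq_diff z = (Ln (1 + z))\<^sup>2 - (Ln (1 - z))\<^sup>2"

lemma one_plus_notin_nonpos_Reals:
  assumes "Re z > - 1" shows "1 + z \<notin> \<real>\<^sub>\<le>\<^sub>0"
  using assms by (auto simp: complex_nonpos_Reals_iff)

lemma log_sq_diff_field_differentiable:
  assumes "\<bar>Re z\<bar> < 1" shows "log_sq_diff field_differentiable at z"
proof (rule holomorphic_on_imp_differentiable_at)
  show "log_sq_diff holomorphic_on {z. \<bar>Re z\<bar> < 1}"
    unfolding log_sq_diff_def[abs_def]
  proof (intro holomorphic_intros)
    fix z assume z: "z \<in> {z. \<bar>Re z\<bar> < 1}"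
    show "1 + z \<notin> \<real>\<^sub>\<le>\<^sub>0" "1 - z \<notin> \<real>\<^sub>\<le>\<^sub>0"
      using one_plus_notin_nonpos_Reals[of z] one_plus_notin_nonpos_Reals[of "- z"] z by auto
  qed
  show "open {z. \<bar>Re z\<bar> < 1}"
    by (intro open_Collect_less continuous_intros)
qed (use assms in auto)

text \<open>Value and derivative of \<open>log_sq_diff\<close> vanish at 0, so the quotient extends
  continuously by 0; on a convex set a primitive exists even if differentiability is checked only
  off a finite set. At 0 continuity of \<open>G\<close> suffices, since 0 is only an endpoint of the
  two radii.\<close>

lemma log_sq_diff_primitive:
  obtains G where "\<And>z. norm z < 1 \<Longrightarrow> z \<noteq> 0 \<Longrightarrow> (G has_field_derivative log_sq_diff z / z) (at z)"
    and "isCont G 0"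
proof -
  define f where "f z = (if z = 0 then 0 else log_sq_diff z / z)" for z
  have Re_lt: "\<bar>Re z\<bar> < 1" if "z \<in> ball 0 1" for z :: complex
    using that abs_Re_le_cmod[of z] by simp
  have diff: "f field_differentiable at z" if z: "z \<in> ball 0 1" "z \<noteq> 0" for z
  proof -
    have "(\<lambda>z. log_sq_diff z / z) field_differentiable at z"
      using z by (intro derivative_intros log_sq_diff_field_differentiable Re_lt) auto
    then obtain D where "((\<lambda>z. log_sq_diff z / z) has_field_derivative D) (at z)"
      by (auto simp: field_differentiable_def)
    hence "(f has_field_derivative D) (at z)"
      by (rule has_field_derivative_transform_within_open[where S = "- {0}"]) (use z in \<open>auto simp: f_def\<close>)
    thus ?thesis by (auto simp: field_differentiable_def)
  qed
  have "(log_sq_diff has_field_derivative 0) (at 0)"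
    unfolding log_sq_diff_def[abs_def] by (auto intro!: derivative_eq_intros)
  hence "(f \<longlongrightarrow> 0) (at 0)"
    unfolding has_field_derivative_iff
    by (rule Lim_transform_eventually) (auto simp: f_def log_sq_diff_def eventually_at intro!: exI[of _ 1])
  hence "isCont f 0" by (simp add: isCont_def f_def)
  hence cont: "continuous_on (ball 0 1) f"
    using diff field_differentiable_imp_continuous_at
    by (intro continuous_at_imp_continuous_on) blast
  obtain G where G: "\<And>z. z \<in> ball 0 1 \<Longrightarrow> (G has_field_derivative f z) (at z within ball 0 1)"
    by (rule holomorphic_convex_primitive[of "ball 0 1" "{0}" f]) (use cont diff in \<open>auto simp: interior_open\<close>)
  hence G': "(G has_field_derivative f z) (at z)" if "norm z < 1" for z
    using that G[of z] by (simp add: at_within_open[of z "ball 0 1"])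
  show thesis
  proof (rule that)
    show "(G has_field_derivative log_sq_diff z / z) (at z)" if "norm z < 1" "z \<noteq> 0" for z
      using G'[of z] that by (simp add: f_def)
    show "isCont G 0" using G'[of 0] DERIV_isCont by fastforce
  qed
qed

lemma log_sq_diff_of_real: "\<bar>x\<bar> < 1 \<Longrightarrow> Im (log_sq_diff (of_real x)) = 0"
proof -
  assume x: "\<bar>x\<bar> < 1"
  have "Ln (of_real (1 + x)) = of_real (ln (1 + x))" "Ln (of_real (1 - x)) = of_real (ln (1 - x))"
    using x by (simp_all add: Ln_of_real del: of_real_add of_real_diff)
  thus ?thesis by (simp add: log_sq_diff_def Im_power2)
qed

lemma Im_log_sq_diff_imag: "Im (log_sq_diff (\<i> * of_real y)) = 2 * arctan y * ln (1 + y\<^sup>2)"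
proof -
  define a where "a = Ln (1 + \<i> * of_real y)"
  have nonpos: "1 + \<i> * of_real y \<notin> \<real>\<^sub>\<le>\<^sub>0" by (auto simp: complex_nonpos_Reals_iff)
  have "1 - \<i> * of_real y = cnj (1 + \<i> * of_real y)" by (simp add: complex_eq_iff)
  hence "Ln (1 - \<i> * of_real y) = cnj a" using nonpos by (simp add: a_def cnj_Ln)
  hence "Im (log_sq_diff (\<i> * of_real y)) = 4 * Re a * Im a"
    by (simp add: log_sq_diff_def a_def[symmetric] Im_power2)
  moreover have "Re a = ln (1 + y\<^sup>2) / 2"
  proof -
    have "1 + \<i> * of_real y \<noteq> 0" by (simp add: complex_eq_iff)
    hence "Re a = ln (sqrt (1 + y\<^sup>2))" by (simp add: a_def cmod_def)
    thus ?thesis using one_plus_square_pos[of y] by (simp add: ln_sqrt)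
  qed
  moreover have "Im a = arctan y"
    using Im_Ln_eq[of "1 + \<i> * of_real y"] unfolding a_def by (auto simp: complex_eq_iff)
  ultimately show ?thesis by simp
qed

text \<open>Im G agrees at 0 and at rho, as \<open>log_sq_diff\<close> is real on the real radius.
  On the imaginary radius dz/z = dy/y; on the arc dz/z = i dt, which turns the imaginary part into a
  real part. Comparing the increments of Im G along both ways to i rho gives the claim.\<close>

lemma integral_log_sq_diff_arc:
  assumes rho: "0 < \<rho>" "\<rho> < 1"
    and int: "((\<lambda>y. 2 * arctan y * ln (1 + y\<^sup>2) / y) has_integral J) {0<..<\<rho>}"
  shows "((\<lambda>t. Re (log_sq_diff (of_real \<rho> * cis t))) has_integral J) {0<..<pi / 2}"
proof -
  obtain G where G: "\<And>z. norm z < 1 \<Longrightarrow> z \<noteq> 0 \<Longrightarrow> (G has_field_derivative log_sq_diff z / z) (at z)"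
    and G0: "isCont G 0" by (rule log_sq_diff_primitive) blast
  have G_cont: "isCont G z" if "norm z < 1" for z
    using G[of z] G0 that DERIV_isCont by (cases "z = 0") auto
  have path_deriv: "((\<lambda>x. Im (G (p x))) has_real_derivative Im (log_sq_diff (p x) / p x * p')) (at x)"
    if "(p has_vector_derivative p') (at x)" "norm (p x) < 1" "p x \<noteq> 0" for p :: "real \<Rightarrow> complex" and p' x
  proof -
    have "((G \<circ> p) has_vector_derivative p' * (log_sq_diff (p x) / p x)) (at x)"
      using G[of "p x"] that by (intro field_vector_diff_chain_at) auto
    from bounded_linear.has_vector_derivative[OF bounded_linear_Im this]
    show ?thesis by (simp add: o_def has_real_derivative_iff_has_vector_derivative mult.commute)
  qed
  have "((\<lambda>x. 0) has_integral (Im (G (of_real \<rho>)) - Im (G (of_real 0)))) {0<..<\<rho>}"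
  proof (rule has_integral_FTC_Ioo)
    have "isCont (\<lambda>x. Im (G (of_real x))) x" if "norm (complex_of_real x) < 1" for x
      by (intro isCont_Im isCont_o2[where f = of_real and g = G] G_cont that) auto
    from isCont_tendsto_within[OF this, of 0] isCont_tendsto_within[OF this, of \<rho>]
    show "((\<lambda>x. Im (G (of_real x))) \<longlongrightarrow> Im (G (of_real 0))) (at_right 0)"
      "((\<lambda>x. Im (G (of_real x))) \<longlongrightarrow> Im (G (of_real \<rho>))) (at_left \<rho>)"
      using rho by auto
    fix x assume x: "0 < x" "x < \<rho>"
    have "((\<lambda>x. Im (G (of_real x))) has_real_derivative Im (log_sq_diff (of_real x) / of_real x * 1)) (at x)"
      using x rho by (intro path_deriv) (auto intro!: derivative_eq_intros)
    thus "((\<lambda>x. Im (G (of_real x))) has_real_derivative 0) (at x)"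
      using log_sq_diff_of_real[of x] x rho by (simp add: Im_divide_of_real)
  qed (use rho in auto)
  hence re: "Im (G (of_real \<rho>)) = Im (G 0)"
    using has_integral_unique[OF _ has_integral_0] by fastforce
  have "((\<lambda>y. 2 * arctan y * ln (1 + y\<^sup>2) / y) has_integral (Im (G (\<i> * of_real \<rho>)) - Im (G (\<i> * of_real 0)))) {0<..<\<rho>}"
  proof (rule has_integral_FTC_Ioo)
    have "isCont (\<lambda>x. Im (G (\<i> * of_real x))) x" if "norm (\<i> * complex_of_real x) < 1" for x
      by (intro isCont_Im isCont_o2[where f = "\<lambda>x. \<i> * of_real x" and g = G] G_cont that) (auto intro!: continuous_intros)
    from isCont_tendsto_within[OF this, of 0] isCont_tendsto_within[OF this, of \<rho>]
    show "((\<lambda>x. Im (G (\<i> * of_real x))) \<longlongrightarrow> Im (G (\<i> * of_real 0))) (at_right 0)"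
      "((\<lambda>x. Im (G (\<i> * of_real x))) \<longlongrightarrow> Im (G (\<i> * of_real \<rho>))) (at_left \<rho>)"
      using rho by (auto simp: norm_mult)
    fix y assume y: "0 < y" "y < \<rho>"
    have "((\<lambda>x. Im (G (\<i> * of_real x))) has_real_derivative Im (log_sq_diff (\<i> * of_real y) / (\<i> * of_real y) * \<i>)) (at y)"
      using y rho by (intro path_deriv) (auto intro!: derivative_eq_intros simp: norm_mult)
    also have "Im (log_sq_diff (\<i> * of_real y) / (\<i> * of_real y) * \<i>) = 2 * arctan y * ln (1 + y\<^sup>2) / y"
      using y by (simp add: Im_log_sq_diff_imag Im_divide_of_real flip: Im_divide_of_real)
    finally show "((\<lambda>x. Im (G (\<i> * of_real x))) has_real_derivative 2 * arctan y * ln (1 + y\<^sup>2) / y) (at y)" .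
  qed (use rho in auto)
  hence im: "J = Im (G (\<i> * of_real \<rho>)) - Im (G 0)"
    using has_integral_unique[OF int] by auto
  define p where "p t = of_real \<rho> * cis t" for t
  have p: "norm (p t) < 1" "p t \<noteq> 0" for t
    using rho by (auto simp: p_def norm_mult)
  have dp: "(p has_vector_derivative (\<i> * p t)) (at t)" for t
  proof -
    have "((\<lambda>z. of_real \<rho> * exp (\<i> * z)) has_field_derivative (of_real \<rho> * exp (\<i> * of_real t) * \<i>)) (at (of_real t))"
      by (auto intro!: derivative_eq_intros)
    from has_vector_derivative_real_field[OF this] show ?thesis
      by (simp add: p_def[abs_def] cis_conv_exp mult_ac)
  qed
  have "((\<lambda>t. Re (log_sq_diff (p t))) has_integral (Im (G (p (pi / 2))) - Im (G (p 0)))) {0<..<pi / 2}"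
  proof (rule has_integral_FTC_Ioo)
    fix t
    have "((\<lambda>t. Im (G (p t))) has_real_derivative Im (log_sq_diff (p t) / p t * (\<i> * p t))) (at t)"
      by (rule path_deriv[OF dp p])
    also have "log_sq_diff (p t) / p t * (\<i> * p t) = \<i> * log_sq_diff (p t)" using p by simp
    finally show D: "((\<lambda>t. Im (G (p t))) has_real_derivative Re (log_sq_diff (p t))) (at t)" by simp
  next
    have "isCont (\<lambda>t. Im (G (p t))) t" for t
      using path_deriv[OF dp p] by (rule DERIV_isCont)
    thus "((\<lambda>t. Im (G (p t))) \<longlongrightarrow> Im (G (p 0))) (at_right 0)"
      "((\<lambda>t. Im (G (p t))) \<longlongrightarrow> Im (G (p (pi / 2)))) (at_left (pi / 2))"
      by (rule isCont_tendsto_within)+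
  qed auto
  thus ?thesis using re im by (simp add: p_def mult.commute)
qed

text \<open>With u = t/2, 1 + e^(it) = 2 cos u e^(iu) and 1 - e^(it) = 2 sin u e^(i(u - pi/2)), both
  angles lying in the principal range. The squared moduli logarithms factor as (a - b)(a + b), where
  a - b = -ln tan u and a + b = ln(2 sin t).\<close>

lemma Re_log_sq_diff_cis:
  assumes t: "0 < t" "t < pi / 2"
  shows "Re (log_sq_diff (cis t)) = - ln (tan (t / 2)) * ln (2 * sin t) + (pi\<^sup>2 / 4 - pi / 2 * t)"
proof -
  define u where "u = t / 2"
  have u: "0 < u" "u < pi / 4" "t = 2 * u" using t by (auto simp: u_def)
  have s: "sin u > 0" using u by (intro sin_gt_zero) auto
  have c: "cos u > 0" using u by (intro cos_gt_zero) auto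
  have "1 + cis t = exp (Complex (ln (2 * cos u)) u)"
    unfolding exp_eq_polar using c
    by (simp add: complex_eq_iff u cos_double_cos sin_double power2_eq_square)
  moreover have "Ln (exp (Complex (ln (2 * cos u)) u)) = Complex (ln (2 * cos u)) u"
    using u by (intro Ln_exp) auto
  ultimately have L1: "Ln (1 + cis t) = Complex (ln (2 * cos u)) u" by simp
  have "1 - cis t = exp (Complex (ln (2 * sin u)) (u - pi / 2))"
    unfolding exp_eq_polar using s
    by (simp add: complex_eq_iff u cos_double_sin sin_double power2_eq_square cos_diff sin_diff)
  moreover have "Ln (exp (Complex (ln (2 * sin u)) (u - pi / 2))) = Complex (ln (2 * sin u)) (u - pi / 2)"
    using u by (intro Ln_exp) auto
  ultimately have L2: "Ln (1 - cis t) = Complex (ln (2 * sin u)) (u - pi / 2)" by simp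
  define a b where "a = ln (2 * cos u)" and "b = ln (2 * sin u)"
  have "Re (log_sq_diff (cis t)) = (a - b) * (a + b) + (pi\<^sup>2 / 4 - pi * u)"
    unfolding log_sq_diff_def L1 L2 by (simp add: a_def b_def Re_power2 power2_eq_square algebra_simps)
  also have "a - b = - ln (tan u)"
    using s c by (simp add: a_def b_def tan_def ln_mult ln_div)
  also have "a + b = ln ((2 * cos u) * (2 * sin u))"
    unfolding a_def b_def using s c by (intro ln_mult_pos[symmetric]) auto
  also have "(2 * cos u) * (2 * sin u) = 2 * sin t"
    by (simp add: u sin_double)
  finally show ?thesis by (simp add: u)
qed

text \<open>The bound must not depend on rho, which is to tend to 1. The critical quantity is |1 -
  z|: it is at least sin t, the distance from 1 to the line through 0 in direction t, whatever rho
  is.\<close>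

lemma Re_log_sq_diff_bound:
  assumes t: "0 < t" "t < pi / 2" and rho: "0 < \<rho>" "\<rho> < 1"
  shows "\<bar>Re (log_sq_diff (of_real \<rho> * cis t))\<bar> \<le> 2 * (2 - ln t)\<^sup>2 + 2 * pi\<^sup>2"
proof -
  \<comment> \<open>The modulus of w accounts for (2 - ln t)^2, its principal argument for
    pi^2.\<close>
  have *: "\<bar>Re ((Ln w)\<^sup>2)\<bar> \<le> (2 - ln t)\<^sup>2 + pi\<^sup>2" if w: "t / 2 \<le> norm w" "norm w \<le> 2" for w
  proof -
    have w0: "w \<noteq> 0" using w t by auto
    have "ln (t / 2) \<le> ln (norm w)" using w t by (subst ln_le_cancel_iff) auto
    moreover have "ln (norm w) \<le> ln 2" using w w0 by (subst ln_le_cancel_iff) auto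
    moreover have "ln (2::real) \<le> 1" using ln2_le_25_over_36 by simp
    moreover have "ln t \<le> ln 2" using t pi_less_4 by (subst ln_le_cancel_iff) auto
    moreover have "ln (t / 2) = ln t - ln 2" using t by (simp add: ln_div)
    ultimately have "\<bar>ln (norm w)\<bar> \<le> 2 - ln t" unfolding abs_le_iff by linarith
    hence "\<bar>Re (Ln w)\<bar> \<le> 2 - ln t" using w0 by simp
    from power_mono[OF this, of 2] have "(Re (Ln w))\<^sup>2 \<le> (2 - ln t)\<^sup>2" by simp
    moreover have "\<bar>Im (Ln w)\<bar> \<le> pi" using mpi_less_Im_Ln[OF w0] Im_Ln_le_pi[OF w0] by simp
    from power_mono[OF this, of 2] have "(Im (Ln w))\<^sup>2 \<le> pi\<^sup>2" by simp
    ultimately show ?thesis unfolding Re_power2 by (smt (verit) zero_le_power2)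
  qed
  define z where "z = of_real \<rho> * cis t"
  have nz: "norm z = \<rho>" using rho by (simp add: z_def norm_mult)
  have ct: "cos t > 0" using t by (intro cos_gt_zero) auto
  have st: "sin t > 0" using t by (intro sin_gt_zero) auto
  have "(sin t)\<^sup>2 \<le> (norm (1 - z))\<^sup>2"
  proof -
    have "(norm (1 - z))\<^sup>2 = (1 - \<rho> * cos t)\<^sup>2 + (\<rho> * sin t)\<^sup>2"
      by (simp add: z_def cmod_power2)
    also have "\<dots> = (\<rho> - cos t)\<^sup>2 + (sin t)\<^sup>2"
      unfolding power_mult_distrib sin_squared_eq by (simp add: power2_eq_square algebra_simps)
    finally show ?thesis by simp
  qed
  hence "sin t \<le> norm (1 - z)" by (rule power2_le_imp_le) simp
  moreover have "t / 2 \<le> sin t"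
  proof -
    have "ln t \<le> ln (2 * sin t)" using half_angle_bounds(5)[OF t] .
    thus ?thesis using t st by (subst (asm) ln_le_cancel_iff) auto
  qed
  moreover have "norm (1 - z) \<le> 2" using norm_triangle_ineq4[of 1 z] nz rho by simp
  ultimately have m: "\<bar>Re ((Ln (1 - z))\<^sup>2)\<bar> \<le> (2 - ln t)\<^sup>2 + pi\<^sup>2"
    by (intro *) auto
  have "1 \<le> Re (1 + z)" using ct rho by (simp add: z_def)
  also have "\<dots> \<le> norm (1 + z)" by (rule complex_Re_le_cmod)
  finally have "t / 2 \<le> norm (1 + z)" using t pi_less_4 by simp
  moreover have "norm (1 + z) \<le> 2" using norm_triangle_ineq[of 1 z] nz rho by simp
  ultimately have p: "\<bar>Re ((Ln (1 + z))\<^sup>2)\<bar> \<le> (2 - ln t)\<^sup>2 + pi\<^sup>2"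
    by (intro *) auto
  have "Re (log_sq_diff z) = Re ((Ln (1 + z))\<^sup>2) - Re ((Ln (1 - z))\<^sup>2)"
    by (simp only: log_sq_diff_def minus_complex.simps)
  with m p show ?thesis unfolding z_def[symmetric] by linarith
qed

lemma integral_arctan_ln:
  defines "K \<equiv> \<lambda>x. arctan x / x * ln (1 + x\<^sup>2)"
  assumes K: "K integrable_on {0<..<1}"
  shows "2 * integral {0<..<1} K =
    integral {0<..<pi / 2} (\<lambda>t. - ln (tan (t / 2)) * ln (2 * sin t)) + pi ^ 3 / 16"
proof -
  define r where "r n = 1 - 1 / (real n + 2)" for n
  have r: "0 < r n" "r n < 1" for n by (auto simp: r_def divide_simps)
  have r_lim: "r \<longlonglongrightarrow> 1" unfolding r_def by real_asymp
  define g where "g = (\<lambda>t::real. - ln (tan (t / 2)) * ln (2 * sin t))"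
  \<comment> \<open>The contribution of the arguments of the two logarithms; it integrates to pi^3/8
    - pi^3/16.\<close>
  define A where "A = (\<lambda>t::real. pi\<^sup>2 / 4 - pi / 2 * t)"
  have Kc: "K integrable_on {0..1}" using K by (simp add: integrable_on_Icc_iff_Ioo)
  have arc: "((\<lambda>t. Re (log_sq_diff (of_real (r n) * cis t))) has_integral 2 * integral {0..r n} K) {0<..<pi / 2}" for n
  proof (rule integral_log_sq_diff_arc[OF r])
    have "K integrable_on {0..r n}"
      using r[of n] by (intro integrable_on_subinterval[OF Kc]) auto
    from has_integral_mult_right[OF integrable_integral[OF this], of 2]
    show "((\<lambda>y. 2 * arctan y * ln (1 + y\<^sup>2) / y) has_integral 2 * integral {0..r n} K) {0<..<r n}"
      by (simp add: K_def has_integral_Icc_iff_Ioo mult.assoc)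
  qed
  have lim1: "(\<lambda>n. 2 * integral {0..r n} K) \<longlonglongrightarrow> 2 * integral {0..1} K"
  proof (intro tendsto_intros)
    have "continuous_on {0..1} (\<lambda>x. integral {0..x} K)"
      by (rule indefinite_integral_continuous_1[OF Kc])
    thus "(\<lambda>n. integral {0..r n} K) \<longlonglongrightarrow> integral {0..1} K"
      by (rule continuous_on_tendsto_compose[OF _ r_lim]) (use r in \<open>auto intro!: always_eventually less_imp_le\<close>)
  qed
  have bound: "(\<lambda>t. 2 * (2 - ln t)\<^sup>2 + 2 * pi\<^sup>2) integrable_on {0<..<pi / 2}"
  proof (rule integrable_add)
    show "(\<lambda>t. 2 * (2 - ln t)\<^sup>2) integrable_on {0<..<pi / 2}"
      by (rule integrable_on_mult_right[OF integrable_ln_square])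
    show "(\<lambda>t. 2 * pi\<^sup>2) integrable_on {0<..<pi / 2}"
      by (rule integrable_on_Icc_iff_Ioo[THEN iffD1, OF integrable_const_ivl])
  qed
  have "((\<lambda>t. g t + A t) has_integral 2 * integral {0..1} K) {0<..<pi / 2}"
  proof (rule has_integral_dominated_convergence[OF arc bound _ _ lim1])
    show "\<forall>t\<in>{0<..<pi / 2}. norm (Re (log_sq_diff (of_real (r n) * cis t))) \<le> 2 * (2 - ln t)\<^sup>2 + 2 * pi\<^sup>2" for n
      using Re_log_sq_diff_bound r by auto
    show "\<forall>t\<in>{0<..<pi / 2}. (\<lambda>n. Re (log_sq_diff (of_real (r n) * cis t))) \<longlonglongrightarrow> g t + A t"
    proof
      fix t assume t: "t \<in> {0<..<pi / 2}"
      have "\<bar>cos t\<bar> < 1"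
      proof -
        have "cos t > 0" using t by (intro cos_gt_zero) auto
        moreover have "cos t < cos 0" using t by (intro cos_monotone_0_pi) auto
        ultimately show ?thesis by simp
      qed
      hence "isCont log_sq_diff (cis t)"
        using field_differentiable_imp_continuous_at[OF log_sq_diff_field_differentiable[of "cis t"]] by simp
      moreover have "(\<lambda>n. of_real (r n) * cis t) \<longlonglongrightarrow> of_real 1 * cis t"
        by (intro tendsto_intros r_lim)
      ultimately have "(\<lambda>n. Re (log_sq_diff (of_real (r n) * cis t))) \<longlonglongrightarrow> Re (log_sq_diff (cis t))"
        by (intro tendsto_Re isCont_tendsto_compose[of _ log_sq_diff]) auto
      also have "Re (log_sq_diff (cis t)) = g t + A t"
        using Re_log_sq_diff_cis[of t] t by (simp add: g_def A_def)
      finally show "(\<lambda>n. Re (log_sq_diff (of_real (r n) * cis t))) \<longlonglongrightarrow> g t + A t" .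
    qed
  qed
  moreover have "(A has_integral (pi ^ 3 / 16)) {0<..<pi / 2}"
  proof -
    define F where "F = (\<lambda>t::real. pi\<^sup>2 / 4 * t - pi / 4 * t\<^sup>2)"
    have "(A has_integral (F (pi / 2) - F 0)) {0<..<pi / 2}"
    proof (rule has_integral_FTC_Ioo)
      have "isCont F t" for t unfolding F_def by (intro continuous_intros) auto
      thus "(F \<longlongrightarrow> F 0) (at_right 0)" "(F \<longlongrightarrow> F (pi / 2)) (at_left (pi / 2))"
        by (rule isCont_tendsto_within)+
    qed (auto simp: F_def A_def intro!: derivative_eq_intros)
    thus ?thesis by (simp add: F_def power2_eq_square power3_eq_cube mult.assoc)
  qed
  ultimately have "((\<lambda>t. g t + A t - A t) has_integral (2 * integral {0..1} K - pi ^ 3 / 16)) {0<..<pi / 2}"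
    by (rule has_integral_diff)
  hence "integral {0<..<pi / 2} g = 2 * integral {0..1} K - pi ^ 3 / 16"
    by (simp add: integral_unique)
  thus ?thesis by (simp add: g_def integral_open_interval_real)
qed

text \<open>\<open>g1\<close> is the integrand of I - E. Both I and E contain T/2, which cancels
  without being evaluated, and pi^3/32 - pi^3/24 = -pi^3/96 remains.\<close>

lemma sums_weight_leib_base: "(\<lambda>k. weight (Suc k) * leib (Suc k)) sums (- (pi ^ 3 / 96))"
proof -
  define g1 where "g1 = (\<lambda>x::real. arctan x / x * (2 * ln (1 + x\<^sup>2) - ln (1 - x\<^sup>2)))"
  define g2 where "g2 = (\<lambda>x. arctan x / x * ln (tcos x))"
  define K where "K = (\<lambda>x::real. arctan x / x * ln (1 + x\<^sup>2))"
  define T where "T = integral {0<..<pi / 2} (\<lambda>t. - ln (tan (t / 2)) * ln (2 * sin t))"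
  have g1: "g1 integrable_on {0<..<1}" and g2: "g2 integrable_on {0<..<1}"
    unfolding g1_def g2_def by (rule sums_weight_leib sums_integral_arctan_ln_tcos)+
  have eq: "g1 x + g2 x = K x" if "x \<in> {0<..<1}" for x
  proof -
    have "ln (tcos x) = ln (1 - x\<^sup>2) - ln (1 + x\<^sup>2)" using that by (intro ln_tcos) auto
    thus ?thesis unfolding g1_def g2_def K_def distrib_left[symmetric] by simp
  qed
  have "K integrable_on {0<..<1}"
    using integrable_add[OF g1 g2] by (rule integrable_eq) (use eq in auto)
  hence I3: "2 * integral {0<..<1} K = T + pi ^ 3 / 16"
    unfolding K_def T_def by (rule integral_arctan_ln)
  have "integral {0<..<1} K = integral {0<..<1} (\<lambda>x. g1 x + g2 x)"
    by (rule integral_cong) (use eq in auto)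
  also have "\<dots> = integral {0<..<1} g1 + integral {0<..<1} g2"
    by (rule integral_add[OF g1 g2])
  finally have sum: "integral {0<..<1} K = integral {0<..<1} g1 + integral {0<..<1} g2" .
  have "2 * integral {0<..<1} g2 = T"
    unfolding g2_def T_def
    by (rule sums_unique2[OF sums_integral_arctan_ln_tcos(2) sums_integral_ln_tan_ln_sin(2)])
  with I3 sum have "integral {0<..<1} g1 - pi ^ 3 / 24 = - (pi ^ 3 / 96)" by simp
  with sums_weight_leib(2) show ?thesis unfolding g1_def by simp
qed

subsection \<open>Dependence on the shift\<close>

definition shift_value :: "nat \<Rightarrow> real" where
  "shift_value d = - pi\<^sup>2 / (6 * (2 * real d + 1))
     + 2 / (2 * real d + 1)\<^sup>2 * (odd_harm (Suc d) + 2 * (- 1) ^ d * leib (Suc d))"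

text \<open>Partial fractions in N, with D = 2d+1. The double pole gives the pi^2 term. The simple
  poles give a digamma value at d + 3/2 in the non-alternating part, and -ln 2 together with a
  Leibniz tail in the alternating part. The ln 2 inside the digamma value cancels the other
  one.\<close>

lemma sums_shift_value:
  "(\<lambda>k. ((- 1) ^ Suc k - 1 / 2) / ((real (Suc k))\<^sup>2 * (2 * real (Suc k) + 2 * real d + 1)))
     sums shift_value d"
proof -
  define D where "D = 2 * real d + 1"
  have D: "D > 0" by (simp add: D_def)
  have s1: "(\<lambda>n. 1 / (real (Suc n))\<^sup>2) sums (pi\<^sup>2 / 6)"
    using inverse_squares_sums by (simp add: add.commute)
  have s3: "(\<lambda>k. 1 / real (Suc k) - 2 / (2 * real (Suc k) + D)) sums (2 * (odd_harm (Suc d) - ln 2))"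
  proof -
    \<comment> \<open>(2N + D)/2 = z + (N - 1), so the series is the defining one of
      \<open>Digamma z\<close>.\<close>
    define z where "z = real (Suc d) + 1 / 2"
    have digamma_sums: "(\<lambda>n. inverse (real (Suc n)) - inverse (z + real n)) sums (Digamma z + euler_mascheroni)"
      using summable_sums[OF summable_Digamma[of z]] by (simp add: Digamma_def z_def)
    have digamma: "Digamma z = 2 * odd_harm (Suc d) - euler_mascheroni - 2 * ln 2"
      unfolding z_def Digamma_half_integer odd_harm_def
      by (simp add: sum_distrib_left add_ac del: sum.lessThan_Suc)
    have "inverse (real (Suc n)) - inverse (z + real n) = 1 / real (Suc n) - 2 / (2 * real (Suc n) + D)" for n
      by (simp add: z_def D_def field_simps)
    with digamma_sums show ?thesis by (simp only: digamma) (simp add: algebra_simps)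
  qed
  have s4: "(\<lambda>k. (- 1) ^ Suc k / real (Suc k)) sums (- ln 2)"
    using sums_minus[OF alternating_harmonic_series_sums] by (simp add: mult.commute)
  have s5: "(\<lambda>k. (- 1) ^ Suc k / (2 * real (Suc k) + D)) sums ((- 1) ^ d * leib (Suc d))"
  proof -
    have "(- 1) ^ d * ((- 1) ^ (k + Suc d) / (2 * real (k + Suc d) + 1)) =
        ((- 1) ^ d * (- 1) ^ d) * (- 1) ^ Suc k / (2 * real (Suc k) + D)" for k
      by (simp add: D_def power_add algebra_simps)
    hence "(- 1) ^ d * ((- 1) ^ (k + Suc d) / (2 * real (k + Suc d) + 1)) =
        (- 1) ^ Suc k / (2 * real (Suc k) + D)" for k
      by (simp add: power_add[symmetric])
    thus ?thesis using sums_mult[OF sums_leib[of "Suc d"], of "(- 1) ^ d"] by (simp only:)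
  qed
  have "((- 1) ^ Suc k - 1 / 2) / ((real (Suc k))\<^sup>2 * (2 * real (Suc k) + 2 * real d + 1)) =
      1 / D * ((- 1) ^ Suc k / (real (Suc k))\<^sup>2 - 1 / 2 * (1 / (real (Suc k))\<^sup>2))
      - 2 / D\<^sup>2 * (((- 1) ^ Suc k / real (Suc k) - 2 * ((- 1) ^ Suc k / (2 * real (Suc k) + D)))
         - 1 / 2 * (1 / real (Suc k) - 2 / (2 * real (Suc k) + D)))" for k
  proof -
    define N e where "N = real (Suc k)" and "e = (- 1 :: real) ^ Suc k"
    have N: "N > 0" by (simp add: N_def)
    have "(e - 1 / 2) / (N\<^sup>2 * (2 * N + D)) = 1 / D * (e / N\<^sup>2 - 1 / 2 * (1 / N\<^sup>2))
      - 2 / D\<^sup>2 * ((e / N - 2 * (e / (2 * N + D))) - 1 / 2 * (1 / N - 2 / (2 * N + D)))"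
    proof -
      have "2 * N + D > 0" using N D by simp
      have E: "1 / (N\<^sup>2 * (2 * N + D)) = 1 / D * (1 / N\<^sup>2) - 2 / D\<^sup>2 * (1 / N - 2 / (2 * N + D))"
        using N D \<open>2 * N + D > 0\<close> by (simp add: divide_simps power2_eq_square)
      have "(e - 1 / 2) * (1 / (N\<^sup>2 * (2 * N + D))) =
         (e - 1 / 2) * (1 / D * (1 / N\<^sup>2) - 2 / D\<^sup>2 * (1 / N - 2 / (2 * N + D)))" by (simp only: E)
      thus ?thesis by (simp add: algebra_simps diff_divide_distrib)
    qed
    thus ?thesis by (simp only: N_def e_def D_def add.assoc)
  qed
  moreover have "(\<lambda>k. 1 / D * ((- 1) ^ Suc k / (real (Suc k))\<^sup>2 - 1 / 2 * (1 / (real (Suc k))\<^sup>2))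
      - 2 / D\<^sup>2 * (((- 1) ^ Suc k / real (Suc k) - 2 * ((- 1) ^ Suc k / (2 * real (Suc k) + D)))
         - 1 / 2 * (1 / real (Suc k) - 2 / (2 * real (Suc k) + D)))) sums
      (1 / D * (- (pi\<^sup>2 / 12) - 1 / 2 * (pi\<^sup>2 / 6))
      - 2 / D\<^sup>2 * ((- ln 2 - 2 * ((- 1) ^ d * leib (Suc d))) - 1 / 2 * (2 * (odd_harm (Suc d) - ln 2))))"
    by (intro sums_diff sums_mult sums_alternating_inverse_squares s1 s3 s4 s5)
  moreover have "1 / D * (- (pi\<^sup>2 / 12) - 1 / 2 * (pi\<^sup>2 / 6))
      - 2 / D\<^sup>2 * ((- ln 2 - 2 * ((- 1) ^ d * leib (Suc d))) - 1 / 2 * (2 * (odd_harm (Suc d) - ln 2)))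
      = shift_value d"
    unfolding shift_value_def D_def[symmetric] using D by (simp add: field_simps)
  ultimately show ?thesis by (simp only:)
qed

text \<open>The index is one more than the d of the overview: the base 0 is d = -1 there, and the
  theorem uses \<open>tail_value (Suc d)\<close> for d = n - 2m.\<close>

fun tail_value :: "nat \<Rightarrow> real" where
  "tail_value 0 = - (pi ^ 3 / 96)"
| "tail_value (Suc d) = tail_value d - (- 1) ^ d * shift_value d"

text \<open>Raising the offset removes the first term (-1)^(N+d)/(2N+2d+1) from each tail. Since c_N
  (-1)^N = ((-1)^N - 1/2)/N^2, the removed terms form (-1)^d times the series of
  \<open>shift_value d\<close>.\<close>

lemma sums_tail_value: "(\<lambda>k. weight (Suc k) * leib (Suc k + d)) sums tail_value d"
proof (induction d)
  case 0
  show ?case using sums_weight_leib_base by simp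
next
  case (Suc d)
  have "weight (Suc k) * leib (Suc k + d) - (- 1) ^ d *
      (((- 1) ^ Suc k - 1 / 2) / ((real (Suc k))\<^sup>2 * (2 * real (Suc k) + 2 * real d + 1)))
      = weight (Suc k) * leib (Suc k + Suc d)" for k
  proof -
    define e where "e = (- 1 :: real) ^ Suc k"
    have e2: "e * e = 1" by (simp add: e_def power_add[symmetric])
    have "weight (Suc k) * e = (e - 1 / 2 * (e * e)) / (real (Suc k))\<^sup>2"
      by (simp only: weight_def e_def[symmetric]) (simp add: algebra_simps)
    hence "weight (Suc k) * e = (e - 1 / 2) / (real (Suc k))\<^sup>2"
      by (simp add: e2)
    moreover have "weight (Suc k) * leib (Suc k + Suc d) =
        weight (Suc k) * leib (Suc k + d) - (weight (Suc k) * e) * (- 1) ^ d / (2 * real (Suc k) + 2 * real d + 1)"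
    proof -
      have "leib (Suc k + Suc d) = leib (Suc k + d) - e * (- 1) ^ d / (2 * real (Suc k) + 2 * real d + 1)"
        using leib_Suc[of "Suc k + d"] by (simp add: e_def power_add algebra_simps)
      thus ?thesis by (simp only: right_diff_distrib) simp
    qed
    ultimately show ?thesis by (simp add: e_def mult.commute)
  qed
  with sums_diff[OF Suc sums_mult[OF sums_shift_value[of d], of "(- 1) ^ d"]] show ?case
    by simp
qed

text \<open>For N = k + 2m the denominator is (2N)^2, whose 4 cancels the factor 4 of
  \<open>Digamma_diff_eq_leib\<close>, and (-1)^N = (-1)^k. The series over k lacks the terms N <=
  2m; they form the finite sum that is subtracted.\<close>

lemma digamma_summand_sums:
  assumes n: "n = 2 * m + d"
  shows "(\<lambda>k. digamma_summand m n (Suc k)) sums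
    ((- 1) ^ d * (tail_value (Suc d) - (\<Sum>k=1..2 * m. weight k * leib (Suc (k + d)))))"
proof -
  define f where "f k = weight (Suc k) * leib (Suc k + Suc d)" for k
  have "(\<lambda>k. f (k + 2 * m)) sums (tail_value (Suc d) - (\<Sum>k<2 * m. f k))"
    unfolding f_def by (rule sums_split_initial_segment[OF sums_tail_value])
  hence "(\<lambda>k. (- 1) ^ d * f (k + 2 * m)) sums ((- 1) ^ d * (tail_value (Suc d) - (\<Sum>k<2 * m. f k)))"
    by (rule sums_mult)
  moreover have "(- 1) ^ d * f (k + 2 * m) = digamma_summand m n (Suc k)" for k
  proof -
    define a N e where "a = Suc k + n" and "N = real (Suc k + 2 * m)" and "e = (- 1 :: real) ^ Suc k"
    have e2: "e * e = 1" by (simp add: e_def power_add[symmetric])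
    have sgn: "(- 1) ^ Suc a = - e * (- 1) ^ d"
      unfolding a_def e_def n by (simp add: power_add power_mult)
    have "2 * real (Suc k) + 2 * real n = 2 * real a" by (simp add: a_def)
    hence "digamma_summand m n (Suc k) = 4 * (- 1) ^ Suc a * leib (Suc a) * (1 / 2 - e) / (2 * N)\<^sup>2"
      unfolding digamma_summand_def Digamma_diff_eq_leib[symmetric] by (simp add: N_def e_def)
    also have "\<dots> = (- 1) ^ Suc a * leib (Suc a) * (1 / 2 - e) / N\<^sup>2"
      by (simp add: power_mult_distrib)
    also have "\<dots> = (- 1) ^ d * leib (Suc a) * (e * (e - 1 / 2)) / N\<^sup>2"
      unfolding sgn by (simp add: algebra_simps)
    also have "e * (e - 1 / 2) = 1 - 1 / 2 * e"
      using e2 by (simp add: algebra_simps)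
    also have "(- 1) ^ d * leib (Suc a) * (1 - 1 / 2 * e) / N\<^sup>2 = (- 1) ^ d * f (k + 2 * m)"
    proof -
      have "Suc (k + 2 * m) + Suc d = Suc a" by (simp add: a_def n)
      thus ?thesis unfolding f_def weight_def N_def e_def by (simp add: power_add power_mult)
    qed
    finally show ?thesis ..
  qed
  moreover have "(\<Sum>k<2 * m. f k) = (\<Sum>k=1..2 * m. weight k * leib (Suc (k + d)))"
    unfolding f_def by (rule sum.reindex_bij_witness[of _ "\<lambda>k. k - 1" Suc]) auto
  ultimately show ?thesis by simp
qed


section \<open>Closed forms of the tail values, in steps of two\<close>

lemma tail_value_even_step:
  defines "a \<equiv> \<lambda>j. 4 * real j + 3" and "b \<equiv> \<lambda>j. 4 * real j + 5"
  shows "tail_value (Suc (2 * Suc p)) = tail_value (Suc (2 * p))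
    + 16 * ((real p + 1) * (2 * harm (4 * p + 3) - harm (2 * p + 1)) / ((b p)\<^sup>2 * (a p)\<^sup>2))
    + 2 * (1 / b p ^ 3)
    - (2 * (16 * (real p)\<^sup>2 + 32 * real p + 17) / ((b p)\<^sup>2 * (a p)\<^sup>2)) * (4 * leib (2 * p + 2))
    - 1 / (b p * a p) * (pi\<^sup>2 / 3)"
proof -
  define x L M where "x = real p" and "L = leib (2 * p + 2)" and "M = odd_harm (2 * p + 2)"
  have pos: "4 * x + 3 > 0" "4 * x + 5 > 0" by (simp_all add: x_def add_pos_nonneg)
  have ne: "4 * x + 3 \<noteq> 0" "4 * x + 5 \<noteq> 0" using pos by auto
  have H: "2 * harm (4 * p + 3) - harm (2 * p + 1) = 2 * M"
  proof -
    have "4 * p + 3 = 2 * (2 * p + 1) + 1" "2 * p + 2 = Suc (2 * p + 1)" by simp_all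
    thus ?thesis using odd_harm_eq_harm[of "2 * p + 1"] by (simp only: M_def)
  qed
  have M': "odd_harm (2 * p + 3) = M + 1 / (4 * x + 5)"
  proof -
    have "Suc (2 * p + 2) = 2 * p + 3" "2 * real (2 * p + 2) + 1 = 4 * x + 5" by (simp_all add: x_def)
    thus ?thesis using odd_harm_Suc[of "2 * p + 2"] by (simp only: M_def)
  qed
  have L': "leib (2 * p + 3) = L - 1 / (4 * x + 5)"
  proof -
    have "Suc (2 * p + 2) = 2 * p + 3" "2 * real (2 * p + 2) + 1 = 4 * x + 5" "(- 1 :: real) ^ (2 * p + 2) = 1"
      by (simp_all add: x_def)
    thus ?thesis using leib_Suc[of "2 * p + 2"] by (simp only: L_def)
  qed
  have s1: "shift_value (2 * p + 1) = - pi\<^sup>2 / (6 * (4 * x + 3)) + 2 / (4 * x + 3)\<^sup>2 * (M - 2 * L)"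
  proof -
    have "Suc (2 * p + 1) = 2 * p + 2" "2 * real (2 * p + 1) + 1 = 4 * x + 3" "(- 1 :: real) ^ (2 * p + 1) = - 1"
      by (simp_all add: x_def)
    thus ?thesis by (simp only: shift_value_def M_def L_def) simp
  qed
  \<comment> \<open>Both \<open>odd_harm\<close> and \<open>leib\<close> have moved on by one term.
    The changes 1/B and -2/B, where B = 4x + 5, leave -1/B: the source of the reciprocal
    cubes.\<close>
  have s2: "shift_value (2 * p + 2) = - pi\<^sup>2 / (6 * (4 * x + 5))
      + 2 / (4 * x + 5)\<^sup>2 * (M + 1 / (4 * x + 5) + 2 * (L - 1 / (4 * x + 5)))"
  proof -
    have "Suc (2 * p + 2) = 2 * p + 3" "2 * real (2 * p + 2) + 1 = 4 * x + 5" "(- 1 :: real) ^ (2 * p + 2) = 1"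
      by (simp_all add: x_def)
    thus ?thesis by (simp only: shift_value_def M' L') simp
  qed
  have "tail_value (Suc (2 * Suc p)) = tail_value (Suc (2 * p)) + (shift_value (2 * p + 1) - shift_value (2 * p + 2))"
  proof -
    have "Suc (2 * Suc p) = Suc (Suc (Suc (2 * p)))" "2 * p + 1 = Suc (2 * p)" "2 * p + 2 = Suc (Suc (2 * p))"
      by simp_all
    thus ?thesis by (simp only: tail_value.simps) simp
  qed
  also have "shift_value (2 * p + 1) - shift_value (2 * p + 2) =
      16 * ((x + 1) * (2 * M) / ((4 * x + 5)\<^sup>2 * (4 * x + 3)\<^sup>2))
      + 2 * (1 / (4 * x + 5) ^ 3)
      - (2 * (16 * x\<^sup>2 + 32 * x + 17) / ((4 * x + 5)\<^sup>2 * (4 * x + 3)\<^sup>2)) * (4 * L)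
      - 1 / ((4 * x + 5) * (4 * x + 3)) * (pi\<^sup>2 / 3)"
  proof -
    \<comment> \<open>The polynomials of the result come from these two denominators: 1/A^2 - 1/B^2
      multiplies the harmonic part, 1/A^2 + 1/B^2 the Leibniz part (whose sign alternates with the
      offset), and 1/A - 1/B with B - A = 2 the pi^2 part.\<close>
    define A B where "A = 4 * x + 3" and "B = 4 * x + 5"
    have AB: "A \<noteq> 0" "B \<noteq> 0" using ne by (simp_all add: A_def B_def)
    have e1: "x + 1 = (B\<^sup>2 - A\<^sup>2) / 16" by (simp add: A_def B_def power2_eq_square algebra_simps)
    have e2: "2 * (16 * x\<^sup>2 + 32 * x + 17) = A\<^sup>2 + B\<^sup>2" by (simp add: A_def B_def power2_eq_square algebra_simps)
    have "- pi\<^sup>2 / (6 * A) + pi\<^sup>2 / (6 * B) = - (1 / (B * A) * (pi\<^sup>2 / 3)) * ((B - A) / 2)"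
      using AB by (simp add: field_simps)
    also have "(B - A) / 2 = 1" by (simp add: A_def B_def)
    finally have p1: "- pi\<^sup>2 / (6 * A) + pi\<^sup>2 / (6 * B) = - (1 / (B * A) * (pi\<^sup>2 / 3))" by simp
    have p2: "2 / A\<^sup>2 * M - 2 / B\<^sup>2 * M = 16 * ((B\<^sup>2 - A\<^sup>2) / 16 * (2 * M) / (B\<^sup>2 * A\<^sup>2))"
      using AB by (simp add: field_simps)
    have p3: "2 / A\<^sup>2 * (2 * L) + 2 / B\<^sup>2 * (2 * L) = (A\<^sup>2 + B\<^sup>2) / (B\<^sup>2 * A\<^sup>2) * (4 * L)"
      using AB by (simp add: field_simps)
    have p4: "2 / B\<^sup>2 * (1 / B) = 2 * (1 / B ^ 3)"
      by (simp add: power2_eq_square power3_eq_cube)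
    show ?thesis
      unfolding s1 s2 A_def[symmetric] B_def[symmetric] e1 e2
      using p1 p2 p3 p4 unfolding distrib_left right_diff_distrib by linarith
  qed
  finally show ?thesis
    unfolding H a_def b_def x_def[symmetric] L_def[symmetric] by simp
qed

lemma tail_value_odd_step:
  defines "a \<equiv> \<lambda>j. 4 * real j + 1" and "b \<equiv> \<lambda>j. 4 * real j + 3"
  shows "tail_value (2 * Suc p + 2) = tail_value (2 * p + 2)
    - (8 * ((2 * real (Suc p) + 1) * (2 * harm (4 * Suc p + 1) - harm (2 * Suc p)) / ((b (Suc p))\<^sup>2 * (a (Suc p))\<^sup>2))
    + 2 * (1 / b (Suc p) ^ 3)
    + (2 * (16 * (real (Suc p))\<^sup>2 + 16 * real (Suc p) + 5) / ((b (Suc p))\<^sup>2 * (a (Suc p))\<^sup>2)) * (4 * leib (2 * Suc p + 1))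
    - 1 / 3 * (1 / (b (Suc p) * a (Suc p))) * pi\<^sup>2)"
proof -
  \<comment> \<open>The sums of the odd form start at 1, so the summand of index q belongs to the
    step from offset 2q to 2q + 2.\<close>
  define q where "q = Suc p"
  define x L M where "x = real q" and "L = leib (2 * q + 1)" and "M = odd_harm (2 * q + 1)"
  have pos: "4 * x + 1 > 0" "4 * x + 3 > 0" by (simp_all add: x_def add_nonneg_pos)
  have ne: "4 * x + 1 \<noteq> 0" "4 * x + 3 \<noteq> 0" using pos by auto
  have H: "2 * harm (4 * q + 1) - harm (2 * q) = 2 * M"
    using odd_harm_eq_harm[of "2 * q"] by (simp add: M_def)
  have M': "odd_harm (2 * q + 2) = M + 1 / (4 * x + 3)"
  proof -
    have "Suc (2 * q + 1) = 2 * q + 2" "2 * real (2 * q + 1) + 1 = 4 * x + 3" by (simp_all add: x_def)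
    thus ?thesis using odd_harm_Suc[of "2 * q + 1"] by (simp only: M_def)
  qed
  have L': "leib (2 * q + 2) = L + 1 / (4 * x + 3)"
    using leib_Suc[of "2 * q + 1"] by (simp add: L_def x_def)
  have s1: "shift_value (2 * q) = - pi\<^sup>2 / (6 * (4 * x + 1)) + 2 / (4 * x + 1)\<^sup>2 * (M + 2 * L)"
    unfolding shift_value_def by (simp add: M_def L_def x_def)
  have s2: "shift_value (2 * q + 1) = - pi\<^sup>2 / (6 * (4 * x + 3))
      + 2 / (4 * x + 3)\<^sup>2 * (M + 1 / (4 * x + 3) - 2 * (L + 1 / (4 * x + 3)))"
  proof -
    have "Suc (2 * q + 1) = 2 * q + 2" "2 * real (2 * q + 1) + 1 = 4 * x + 3" "(- 1 :: real) ^ (2 * q + 1) = - 1"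
      by (simp_all add: x_def)
    thus ?thesis by (simp only: shift_value_def M' L') simp
  qed
  have "tail_value (2 * q + 2) = tail_value (2 * q) - (shift_value (2 * q) - shift_value (2 * q + 1))"
  proof -
    have "2 * q + 2 = Suc (Suc (2 * q))" "2 * q + 1 = Suc (2 * q)"
      by simp_all
    thus ?thesis by (simp only: tail_value.simps) simp
  qed
  also have "shift_value (2 * q) - shift_value (2 * q + 1) =
      8 * ((2 * x + 1) * (2 * M) / ((4 * x + 3)\<^sup>2 * (4 * x + 1)\<^sup>2))
      + 2 * (1 / (4 * x + 3) ^ 3)
      + (2 * (16 * x\<^sup>2 + 16 * x + 5) / ((4 * x + 3)\<^sup>2 * (4 * x + 1)\<^sup>2)) * (4 * L)
      - 1 / 3 * (1 / ((4 * x + 3) * (4 * x + 1))) * pi\<^sup>2"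
  proof -
    define A B where "A = 4 * x + 1" and "B = 4 * x + 3"
    have AB: "A \<noteq> 0" "B \<noteq> 0" using ne by (simp_all add: A_def B_def)
    have e1: "2 * x + 1 = (B\<^sup>2 - A\<^sup>2) / 8" by (simp add: A_def B_def power2_eq_square algebra_simps)
    have e2: "2 * (16 * x\<^sup>2 + 16 * x + 5) = A\<^sup>2 + B\<^sup>2" by (simp add: A_def B_def power2_eq_square algebra_simps)
    have "- pi\<^sup>2 / (6 * A) + pi\<^sup>2 / (6 * B) = - (1 / 3 * (1 / (B * A)) * pi\<^sup>2) * ((B - A) / 2)"
      using AB by (simp add: field_simps)
    also have "(B - A) / 2 = 1" by (simp add: A_def B_def)
    finally have p1: "- pi\<^sup>2 / (6 * A) + pi\<^sup>2 / (6 * B) = - (1 / 3 * (1 / (B * A)) * pi\<^sup>2)" by simp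
    have p2: "2 / A\<^sup>2 * M - 2 / B\<^sup>2 * M = 8 * ((B\<^sup>2 - A\<^sup>2) / 8 * (2 * M) / (B\<^sup>2 * A\<^sup>2))"
      using AB by (simp add: field_simps)
    have p3: "2 / A\<^sup>2 * (2 * L) + 2 / B\<^sup>2 * (2 * L) = (A\<^sup>2 + B\<^sup>2) / (B\<^sup>2 * A\<^sup>2) * (4 * L)"
      using AB by (simp add: field_simps)
    have p4: "2 / B\<^sup>2 * (1 / B) = 2 * (1 / B ^ 3)"
      by (simp add: power2_eq_square power3_eq_cube)
    show ?thesis
      unfolding s1 s2 A_def[symmetric] B_def[symmetric] e1 e2
      using p1 p2 p3 p4 unfolding distrib_left right_diff_distrib by linarith
  qed
  also have "tail_value (2 * q) = tail_value (2 * p + 2)" by (simp add: q_def)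
  finally show ?thesis
    unfolding q_def[symmetric] H a_def b_def x_def[symmetric] L_def[symmetric] by simp
qed

lemma tail_value_even:
  "tail_value (Suc (2 * p)) = 2
     + 16 * (\<Sum>j<p. (real j + 1) * (2 * harm (4 * j + 3) - harm (2 * j + 1))
               / ((4 * real j + 5)\<^sup>2 * (4 * real j + 3)\<^sup>2))
     + 2 * (\<Sum>j<p. 1 / (4 * real j + 5) ^ 3)
     + 8 * (\<Sum>k<p. \<Sum>j=0..2 * k + 1. (- 1) ^ j * (16 * (real k)\<^sup>2 + 32 * real k + 17)
              / ((2 * real j + 1) * (4 * real k + 5)\<^sup>2 * (4 * real k + 3)\<^sup>2))
     + (- 1 - (\<Sum>j<p. 2 * (16 * (real j)\<^sup>2 + 32 * real j + 17)
              / ((4 * real j + 5)\<^sup>2 * (4 * real j + 3)\<^sup>2))) * pi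
     + (1 / 2 - (\<Sum>j<p. 1 / ((4 * real j + 5) * (4 * real j + 3)))) * (pi\<^sup>2 / 3)
     - pi ^ 3 / 96"
proof (induction p)
  case 0
  \<comment> \<open>2 - pi + pi^2/6 is the negative of \<open>shift_value 0\<close>.\<close>
  show ?case by (simp add: shift_value_def odd_harm_def leib_def field_simps)
next
  case (Suc p)
  \<comment> \<open>In C * (4 * leib) the tail is pi/4 minus a finite alternating sum: the first
    part goes into the coefficient of pi, the second into the double sum.\<close>
  define C where "C = 2 * (16 * (real p)\<^sup>2 + 32 * real p + 17) / ((4 * real p + 5)\<^sup>2 * (4 * real p + 3)\<^sup>2)"
  have "8 * (\<Sum>j=0..2 * p + 1. (- 1) ^ j * (16 * (real p)\<^sup>2 + 32 * real p + 17)
              / ((2 * real j + 1) * (4 * real p + 5)\<^sup>2 * (4 * real p + 3)\<^sup>2))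
      = 4 * C * (\<Sum>j<2 * p + 2. (- 1) ^ j / (2 * real j + 1))"
    unfolding C_def sum_distrib_left
    by (rule sum.cong) (auto simp: mult_ac)
  also have "\<dots> = C * pi - C * (4 * leib (2 * p + 2))"
    by (simp only: leib_def) (simp add: algebra_simps)
  finally have inner: "C * (4 * leib (2 * p + 2)) = C * pi - 8 * (\<Sum>j=0..2 * p + 1. (- 1) ^ j * (16 * (real p)\<^sup>2 + 32 * real p + 17)
              / ((2 * real j + 1) * (4 * real p + 5)\<^sup>2 * (4 * real p + 3)\<^sup>2))"
    by simp
  show ?case
    unfolding tail_value_even_step Suc sum.lessThan_Suc C_def[symmetric] inner
    by (simp only: ring_distribs left_diff_distrib add_divide_distrib)
qed

lemma tail_value_odd:
  "- tail_value (2 * p + 2) = - (70 / 27)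
     + 8 * (\<Sum>j=1..p. (2 * real j + 1) * (2 * harm (4 * j + 1) - harm (2 * j))
              / ((4 * real j + 3)\<^sup>2 * (4 * real j + 1)\<^sup>2))
     + 2 * (\<Sum>j=1..p. 1 / (4 * real j + 3) ^ 3)
     - 8 * (\<Sum>k=1..p. \<Sum>j=0..2 * k. (- 1) ^ j * (16 * (real k)\<^sup>2 + 16 * real k + 5)
              / ((2 * real j + 1) * (4 * real k + 3)\<^sup>2 * (4 * real k + 1)\<^sup>2))
     + (10 / 9 + (\<Sum>j=1..p. 2 * (16 * (real j)\<^sup>2 + 16 * real j + 5)
              / ((4 * real j + 3)\<^sup>2 * (4 * real j + 1)\<^sup>2))) * pi
     - (1 / 9 + 1 / 3 * (\<Sum>j=1..p. 1 / ((4 * real j + 3) * (4 * real j + 1)))) * pi\<^sup>2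
     + pi ^ 3 / 96"
proof (induction p)
  case 0
  \<comment> \<open>The constants are those of \<open>shift_value 0\<close> -
    \<open>shift_value 1\<close>: 70/27 = 2 + 16/27, 10/9 = 1 + 1/9 and 1/9 = 1/6 - 1/18.\<close>
  show ?case by (simp add: shift_value_def odd_harm_def leib_def eval_nat_numeral field_simps)
next
  case (Suc p)
  define q where "q = Suc p"
  define C where "C = 2 * (16 * (real q)\<^sup>2 + 16 * real q + 5) / ((4 * real q + 3)\<^sup>2 * (4 * real q + 1)\<^sup>2)"
  have "8 * (\<Sum>j=0..2 * q. (- 1) ^ j * (16 * (real q)\<^sup>2 + 16 * real q + 5)
              / ((2 * real j + 1) * (4 * real q + 3)\<^sup>2 * (4 * real q + 1)\<^sup>2))
      = 4 * C * (\<Sum>j<2 * q + 1. (- 1) ^ j / (2 * real j + 1))"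
    unfolding C_def sum_distrib_left
    by (rule sum.cong) (auto simp: mult_ac)
  also have "\<dots> = C * pi - C * (4 * leib (2 * q + 1))"
    by (simp only: leib_def) (simp add: algebra_simps)
  finally have inner: "C * (4 * leib (2 * q + 1)) = C * pi - 8 * (\<Sum>j=0..2 * q. (- 1) ^ j * (16 * (real q)\<^sup>2 + 16 * real q + 5)
              / ((2 * real j + 1) * (4 * real q + 3)\<^sup>2 * (4 * real q + 1)\<^sup>2))"
    by simp
  have split: "(\<Sum>j=1..q. f j) = (\<Sum>j=1..p. f j) + f q" for f :: "nat \<Rightarrow> real"
    by (simp add: q_def)
  have "- tail_value (2 * q + 2) = - tail_value (2 * p + 2)
      + (8 * ((2 * real q + 1) * (2 * harm (4 * q + 1) - harm (2 * q)) / ((4 * real q + 3)\<^sup>2 * (4 * real q + 1)\<^sup>2))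
        + 2 * (1 / (4 * real q + 3) ^ 3) + C * (4 * leib (2 * q + 1))
        - 1 / 3 * (1 / ((4 * real q + 3) * (4 * real q + 1))) * pi\<^sup>2)"
    unfolding q_def tail_value_odd_step C_def by simp
  also note Suc
  finally show ?case
    unfolding q_def[symmetric] split inner C_def[symmetric]
    by (simp only: ring_distribs left_diff_distrib add_divide_distrib)
qed

text \<open>Each tail is pi/4 minus its k + d + 1 missing Leibniz terms, which separates the
  coefficient of pi from the double sum. The numerators (1/2)(-1)^k - 1 are those of the weights
  with reversed sign, and (-1)^n = (-1)^d because 2m is even.\<close>

lemma finite_correction:
  assumes n: "n = 2 * m + d"
  shows "(- 1) ^ d * (\<Sum>k=1..2 * m. weight k * leib (Suc (k + d))) =
    (\<Sum>k=1..2 * m. \<Sum>j=0..k + n - 2 * m.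
       (- 1) ^ (j + n) * (1 / 2 * (- 1) ^ k - 1) / ((real k)\<^sup>2 * (2 * real j + 1)))
    - (\<Sum>k=1..2 * m. (- 1) ^ n * (1 / 2 * (- 1) ^ k - 1) / (4 * (real k)\<^sup>2)) * pi"
proof -
  have "(- 1) ^ d * (weight k * leib (Suc (k + d))) =
      (\<Sum>j=0..k + n - 2 * m. (- 1) ^ (j + n) * (1 / 2 * (- 1) ^ k - 1) / ((real k)\<^sup>2 * (2 * real j + 1)))
      - (- 1) ^ n * (1 / 2 * (- 1) ^ k - 1) / (4 * (real k)\<^sup>2) * pi" for k
  proof -
    have k: "k + n - 2 * m = k + d" and sgn: "(- 1 :: real) ^ n = (- 1) ^ d"
      by (simp_all add: n power_add power_mult)
    have w: "(1 / 2 * (- 1) ^ k - 1) / (real k)\<^sup>2 = - weight k"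
      unfolding weight_def minus_divide_left by (simp only: minus_diff_eq)
    have "(\<Sum>j=0..k + d. (- 1) ^ (j + n) * (1 / 2 * (- 1) ^ k - 1) / ((real k)\<^sup>2 * (2 * real j + 1)))
        = (\<Sum>j=0..k + d. (- 1) ^ d * ((1 / 2 * (- 1) ^ k - 1) / (real k)\<^sup>2) * ((- 1) ^ j / (2 * real j + 1)))"
      by (rule sum.cong) (simp_all add: power_add sgn)
    also have "\<dots> = - ((- 1) ^ d * weight k * (\<Sum>j<Suc (k + d). (- 1) ^ j / (2 * real j + 1)))"
      unfolding w sum_distrib_left[symmetric] by (simp add: atLeast0AtMost lessThan_Suc_atMost del: sum.lessThan_Suc)
    finally have "(\<Sum>j=0..k + d. (- 1) ^ (j + n) * (1 / 2 * (- 1) ^ k - 1) / ((real k)\<^sup>2 * (2 * real j + 1)))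
        = - ((- 1) ^ d * weight k * (\<Sum>j<Suc (k + d). (- 1) ^ j / (2 * real j + 1)))" .
    moreover have "(- 1) ^ n * (1 / 2 * (- 1) ^ k - 1) / (4 * (real k)\<^sup>2) * pi = (- 1) ^ d * (- weight k) * (pi / 4)"
      unfolding sgn w[symmetric] by simp
    ultimately show ?thesis
      unfolding k by (simp only: leib_def) (simp add: algebra_simps del: sum.lessThan_Suc)
  qed
  thus ?thesis
    by (simp only: sum_distrib_left sum_distrib_right sum_subtractf)
qed

theorem theorem11:
  fixes m n :: nat
  assumes "m > 0" and "n > 0" and "n \<ge> 2 * m"
  shows
    "(n = 2 * m \<longrightarrow>
       (\<lambda>k. digamma_summand m n (Suc k)) sums
         (2
          - (\<Sum>k = 1..2 * m. \<Sum>j = 0..k.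
               (- 1) ^ j * (1 / 2 * (- 1) ^ k - 1) / ((real k)\<^sup>2 * (2 * real j + 1)))
          + (- 1 + (\<Sum>k = 1..2 * m. (1 / 2 * (- 1) ^ k - 1) / (4 * (real k)\<^sup>2))) * pi
          + pi\<^sup>2 / 6 - pi ^ 3 / 96))
   \<and> (n = 2 * m + 1 \<longrightarrow>
       (\<lambda>k. digamma_summand m n (Suc k)) sums
         (- (70 / 27)
          + (\<Sum>k = 1..2 * m. \<Sum>j = 0..k + 1.
               (- 1) ^ j * (1 / 2 * (- 1) ^ k - 1) / ((real k)\<^sup>2 * (2 * real j + 1)))
          + (10 / 9 - (\<Sum>k = 1..2 * m. (1 / 2 * (- 1) ^ k - 1) / (4 * (real k)\<^sup>2))) * pi
          - pi\<^sup>2 / 9 + pi ^ 3 / 96))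
   \<and> (odd (n - 2 * m) \<and> n - 2 * m \<noteq> 1 \<longrightarrow>
       (\<lambda>k. digamma_summand m n (Suc k)) sums
         (- (70 / 27)
          + 8 * (\<Sum>j = 1..(n - 2 * m - 1) div 2.
                   (2 * real j + 1) * (2 * harm (4 * j + 1) - harm (2 * j))
                   / ((4 * real j + 3)\<^sup>2 * (4 * real j + 1)\<^sup>2))
          + 2 * (\<Sum>j = 1..(n - 2 * m - 1) div 2. 1 / (4 * real j + 3) ^ 3)
          - (\<Sum>k = 1..2 * m. \<Sum>j = 0..k + n - 2 * m.
               (- 1) ^ (j + n) * (1 / 2 * (- 1) ^ k - 1) / ((real k)\<^sup>2 * (2 * real j + 1)))
          - 8 * (\<Sum>k = 1..(n - 2 * m - 1) div 2. \<Sum>j = 0..2 * k.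
                   (- 1) ^ j * (16 * (real k)\<^sup>2 + 16 * real k + 5)
                   / ((2 * real j + 1) * (4 * real k + 3)\<^sup>2 * (4 * real k + 1)\<^sup>2))
          + (10 / 9
             + (\<Sum>j = 1..(n - 2 * m - 1) div 2.
                  2 * (16 * (real j)\<^sup>2 + 16 * real j + 5)
                  / ((4 * real j + 3)\<^sup>2 * (4 * real j + 1)\<^sup>2))
             + (\<Sum>k = 1..2 * m. (- 1) ^ n * (1 / 2 * (- 1) ^ k - 1) / (4 * (real k)\<^sup>2))) * pi
          - (1 / 9
             + 1 / 3 * (\<Sum>j = 1..(n - 2 * m - 1) div 2.
                          1 / ((4 * real j + 3) * (4 * real j + 1)))) * pi\<^sup>2
          + pi ^ 3 / 96))
   \<and> (even (n - 2 * m) \<longrightarrow>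
       (\<lambda>k. digamma_summand m n (Suc k)) sums
         (2
          + 16 * (\<Sum>j < (n - 2 * m) div 2.
                    (real j + 1) * (2 * harm (4 * j + 3) - harm (2 * j + 1))
                    / ((4 * real j + 5)\<^sup>2 * (4 * real j + 3)\<^sup>2))
          + 2 * (\<Sum>j < (n - 2 * m) div 2. 1 / (4 * real j + 5) ^ 3)
          - (\<Sum>k = 1..2 * m. \<Sum>j = 0..k + n - 2 * m.
               (- 1) ^ (j + n) * (1 / 2 * (- 1) ^ k - 1) / ((real k)\<^sup>2 * (2 * real j + 1)))
          + 8 * (\<Sum>k < (n - 2 * m) div 2. \<Sum>j = 0..2 * k + 1.
                   (- 1) ^ j * (16 * (real k)\<^sup>2 + 32 * real k + 17)
                   / ((2 * real j + 1) * (4 * real k + 5)\<^sup>2 * (4 * real k + 3)\<^sup>2))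
          + (- 1
             - (\<Sum>j < (n - 2 * m) div 2.
                  2 * (16 * (real j)\<^sup>2 + 32 * real j + 17)
                  / ((4 * real j + 5)\<^sup>2 * (4 * real j + 3)\<^sup>2))
             + (\<Sum>k = 1..2 * m. (- 1) ^ n * (1 / 2 * (- 1) ^ k - 1) / (4 * (real k)\<^sup>2))) * pi
          + (1 / 2 - (\<Sum>j < (n - 2 * m) div 2. 1 / ((4 * real j + 5) * (4 * real j + 3))))
              * (pi\<^sup>2 / 3)
          - pi ^ 3 / 96))"
proof (intro conjI impI)
  define S where "S = (\<lambda>k. digamma_summand m n (Suc k))"
  define F where "F = (\<Sum>k=1..2 * m. \<Sum>j=0..k + n - 2 * m.
       (- 1) ^ (j + n) * (1 / 2 * (- 1) ^ k - 1) / ((real k)\<^sup>2 * (2 * real j + 1)))"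
  define P where "P = (\<Sum>k=1..2 * m. (- 1) ^ n * (1 / 2 * (- 1) ^ k - 1) / (4 * (real k)\<^sup>2))"
  have "S sums ((- 1) ^ d * tail_value (Suc d) - F + P * pi)" if "n = 2 * m + d" for d
  proof -
    have "(- 1) ^ d * (tail_value (Suc d) - (\<Sum>k=1..2 * m. weight k * leib (Suc (k + d))))
        = (- 1) ^ d * tail_value (Suc d) - F + P * pi"
      unfolding right_diff_distrib[of _ "tail_value (Suc d)"] finite_correction[OF that] F_def[symmetric] P_def[symmetric] by simp
    with digamma_summand_sums[OF that] show ?thesis
      unfolding S_def by (simp only:)
  qed
  note sums_d = this
  have even_case: "S sums (tail_value (Suc (2 * p)) - F + P * pi)" if "n - 2 * m = 2 * p" for p
    using sums_d[of "2 * p"] that \<open>n \<ge> 2 * m\<close> by (simp add: power_mult)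
  have odd_case: "S sums (- tail_value (2 * p + 2) - F + P * pi)" if "n - 2 * m = 2 * p + 1" for p
  proof -
    have "n = 2 * m + (2 * p + 1)" "Suc (2 * p + 1) = 2 * p + 2" "(- 1 :: real) ^ (2 * p + 1) = - 1"
      using that \<open>n \<ge> 2 * m\<close> by auto
    with sums_d[of "2 * p + 1"] show ?thesis by (simp only:) simp
  qed
  \<comment> \<open>Regrouping with the sums as opaque variables brings \<open>F\<close> and
    \<open>P\<close> to their places in the statement without expanding any sum.\<close>
  have even_arrange: "2 + 16 * a + 2 * b + 8 * c + (- 1 - u) * pi + (1 / 2 - v) * (pi\<^sup>2 / 3) - pi ^ 3 / 96 - F + P * pi
      = 2 + 16 * a + 2 * b - F + 8 * c + (- 1 - u + P) * pi + (1 / 2 - v) * (pi\<^sup>2 / 3) - pi ^ 3 / 96"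
    for a b c u v :: real by (simp add: algebra_simps)
  have odd_arrange: "- (70 / 27) + 8 * a + 2 * b - 8 * c + (10 / 9 + u) * pi - (1 / 9 + 1 / 3 * v) * pi\<^sup>2 + pi ^ 3 / 96 - F + P * pi
      = - (70 / 27) + 8 * a + 2 * b - F - 8 * c + (10 / 9 + u + P) * pi - (1 / 9 + 1 / 3 * v) * pi\<^sup>2 + pi ^ 3 / 96"
    for a b c u v :: real by (simp add: algebra_simps)
  {
    assume n: "n = 2 * m"
    \<comment> \<open>For p = 0 all sums in \<open>tail_value_even\<close> are empty.\<close>
    have "n - 2 * m = 2 * 0" using n by simp
    from even_case[OF this, unfolded tail_value_even even_arrange]
    have "S sums (2 - F + (- 1 + P) * pi + pi\<^sup>2 / 6 - pi ^ 3 / 96)"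
      by simp
    moreover have "F = (\<Sum>k=1..2 * m. \<Sum>j=0..k. (- 1) ^ j * (1 / 2 * (- 1) ^ k - 1) / ((real k)\<^sup>2 * (2 * real j + 1)))"
      unfolding F_def n by (intro sum.cong) (simp_all add: power_add power_mult)
    moreover have "P = (\<Sum>k=1..2 * m. (1 / 2 * (- 1) ^ k - 1) / (4 * (real k)\<^sup>2))"
      unfolding P_def n by (simp add: power_mult)
    ultimately show "(\<lambda>k. digamma_summand m n (Suc k)) sums
         (2
          - (\<Sum>k = 1..2 * m. \<Sum>j = 0..k.
               (- 1) ^ j * (1 / 2 * (- 1) ^ k - 1) / ((real k)\<^sup>2 * (2 * real j + 1)))
          + (- 1 + (\<Sum>k = 1..2 * m. (1 / 2 * (- 1) ^ k - 1) / (4 * (real k)\<^sup>2))) * pi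
          + pi\<^sup>2 / 6 - pi ^ 3 / 96)"
      unfolding S_def by (simp only:)
  next
    assume n: "n = 2 * m + 1"
    have "n - 2 * m = 2 * 0 + 1" using n by simp
    from odd_case[OF this, unfolded tail_value_odd odd_arrange]
    have "S sums (- (70 / 27) - F + (10 / 9 + P) * pi - pi\<^sup>2 / 9 + pi ^ 3 / 96)"
      by simp
    \<comment> \<open>As n is odd here, the sign (-1)^n reverses both \<open>F\<close> and
      \<open>P\<close>.\<close>
    moreover have "F = - (\<Sum>k=1..2 * m. \<Sum>j=0..k + 1. (- 1) ^ j * (1 / 2 * (- 1) ^ k - 1) / ((real k)\<^sup>2 * (2 * real j + 1)))"
      unfolding F_def n sum_negf[symmetric] minus_divide_left by (intro sum.cong) (simp_all add: power_add power_mult)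
    moreover have "P = - (\<Sum>k=1..2 * m. (1 / 2 * (- 1) ^ k - 1) / (4 * (real k)\<^sup>2))"
      unfolding P_def n sum_negf[symmetric] minus_divide_left by (intro sum.cong) (simp_all add: power_add power_mult)
    ultimately show "(\<lambda>k. digamma_summand m n (Suc k)) sums
         (- (70 / 27)
          + (\<Sum>k = 1..2 * m. \<Sum>j = 0..k + 1.
               (- 1) ^ j * (1 / 2 * (- 1) ^ k - 1) / ((real k)\<^sup>2 * (2 * real j + 1)))
          + (10 / 9 - (\<Sum>k = 1..2 * m. (1 / 2 * (- 1) ^ k - 1) / (4 * (real k)\<^sup>2))) * pi
          - pi\<^sup>2 / 9 + pi ^ 3 / 96)"
      unfolding S_def by (simp only: diff_minus_eq_add add_uminus_conv_diff)
  next
    assume "odd (n - 2 * m) \<and> n - 2 * m \<noteq> 1"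
    hence "odd (n - 2 * m)" by (rule conjunct1)
    then obtain p where p: "n - 2 * m = 2 * p + 1" by (rule oddE)
    have "(n - 2 * m - 1) div 2 = p" using p by simp
    with odd_case[OF p, unfolded tail_value_odd odd_arrange] show "(\<lambda>k. digamma_summand m n (Suc k)) sums
         (- (70 / 27)
          + 8 * (\<Sum>j = 1..(n - 2 * m - 1) div 2.
                   (2 * real j + 1) * (2 * harm (4 * j + 1) - harm (2 * j))
                   / ((4 * real j + 3)\<^sup>2 * (4 * real j + 1)\<^sup>2))
          + 2 * (\<Sum>j = 1..(n - 2 * m - 1) div 2. 1 / (4 * real j + 3) ^ 3)
          - (\<Sum>k = 1..2 * m. \<Sum>j = 0..k + n - 2 * m.
               (- 1) ^ (j + n) * (1 / 2 * (- 1) ^ k - 1) / ((real k)\<^sup>2 * (2 * real j + 1)))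
          - 8 * (\<Sum>k = 1..(n - 2 * m - 1) div 2. \<Sum>j = 0..2 * k.
                   (- 1) ^ j * (16 * (real k)\<^sup>2 + 16 * real k + 5)
                   / ((2 * real j + 1) * (4 * real k + 3)\<^sup>2 * (4 * real k + 1)\<^sup>2))
          + (10 / 9
             + (\<Sum>j = 1..(n - 2 * m - 1) div 2.
                  2 * (16 * (real j)\<^sup>2 + 16 * real j + 5)
                  / ((4 * real j + 3)\<^sup>2 * (4 * real j + 1)\<^sup>2))
             + (\<Sum>k = 1..2 * m. (- 1) ^ n * (1 / 2 * (- 1) ^ k - 1) / (4 * (real k)\<^sup>2))) * pi
          - (1 / 9
             + 1 / 3 * (\<Sum>j = 1..(n - 2 * m - 1) div 2.
                          1 / ((4 * real j + 3) * (4 * real j + 1)))) * pi\<^sup>2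
          + pi ^ 3 / 96)"
      unfolding S_def F_def P_def by (simp only:)
  next
    assume "even (n - 2 * m)"
    then obtain p where p: "n - 2 * m = 2 * p" by (rule evenE)
    have "(n - 2 * m) div 2 = p" using p by simp
    with even_case[OF p, unfolded tail_value_even even_arrange] show "(\<lambda>k. digamma_summand m n (Suc k)) sums
         (2
          + 16 * (\<Sum>j < (n - 2 * m) div 2.
                    (real j + 1) * (2 * harm (4 * j + 3) - harm (2 * j + 1))
                    / ((4 * real j + 5)\<^sup>2 * (4 * real j + 3)\<^sup>2))
          + 2 * (\<Sum>j < (n - 2 * m) div 2. 1 / (4 * real j + 5) ^ 3)
          - (\<Sum>k = 1..2 * m. \<Sum>j = 0..k + n - 2 * m.
               (- 1) ^ (j + n) * (1 / 2 * (- 1) ^ k - 1) / ((real k)\<^sup>2 * (2 * real j + 1)))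
          + 8 * (\<Sum>k < (n - 2 * m) div 2. \<Sum>j = 0..2 * k + 1.
                   (- 1) ^ j * (16 * (real k)\<^sup>2 + 32 * real k + 17)
                   / ((2 * real j + 1) * (4 * real k + 5)\<^sup>2 * (4 * real k + 3)\<^sup>2))
          + (- 1
             - (\<Sum>j < (n - 2 * m) div 2.
                  2 * (16 * (real j)\<^sup>2 + 32 * real j + 17)
                  / ((4 * real j + 5)\<^sup>2 * (4 * real j + 3)\<^sup>2))
             + (\<Sum>k = 1..2 * m. (- 1) ^ n * (1 / 2 * (- 1) ^ k - 1) / (4 * (real k)\<^sup>2))) * pi
          + (1 / 2 - (\<Sum>j < (n - 2 * m) div 2. 1 / ((4 * real j + 5) * (4 * real j + 3))))
              * (pi\<^sup>2 / 3)
          - pi ^ 3 / 96)"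
      unfolding S_def F_def P_def by (simp only:)
  }
qed

end
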